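(* Assuming the Hypergraph Dense-vs-Random Conjecture, for every $\varepsilon>0$, no polynomial-time algorithm achieves better than an $O(m^{1/4-\varepsilon}/\log^2 k)$ approximation for Red-Blue Set Cover, where $m$ is the number of sets and $k$ is the number of blue elements.
   Context: Red-Blue Set Cover: we are given a universe $U=R\cup B$ with $R\cap B=\emptyset$, where $R$ is the set of $n$ red elements and $B$ the set of $k$ blue elements, and a collection $\mathcal{S}=\{S_1,\dots,S_m\}$ of subsets of $U$; the goal is to find $\mathcal{F}\subseteq\mathcal{S}$ covering all blue elements while minimizing the number of red elements in the union of $\mathcal{F}$. The Hypergraph Dense-vs-Random Conjecture is the extension to hypergraphs of the Dense-vs-Random conjecture for Densest $k$-Subgraph, as formulated by Chlamtáč, Dinitz and Makarychev (2017) ("Minimizing the union: tight approximations for small set bipartite vertex expansion"); under it, for every $\varepsilon>0$ no polynomial-time algorithm approximates Min $k$-Union (given $m$ sets, choose $k$ of them minimizing the size of their union) within $o(m^{1/4-\varepsilon})$. *)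

theory Defs
  imports
    "HOL-Probability.Probability"
    "HOL-Probability.Product_PMF"
    "HOL-Library.Landau_Symbols"
    "HOL-Computational_Algebra.Polynomial"
begin

section \<open>Polynomial-time computation\<close>

text \<open>
  The machine model is Jones's WHILE language: imperative programs whose variables hold binary
  trees.  An assignment costs one plus the size of the tree it stores, so that sharing of subtrees
  gives no advantage: the total size of all variables never exceeds input size plus running time,
  and polynomial time here is polynomial time on Turing machines.
\<close>

datatype dtree = Tip | Bin dtree dtree

datatype expr = Var nat | Nul | Cns expr expr | Hd expr | Tl expr

type_synonym store = "nat \<Rightarrow> dtree"

primrec hd_tree :: "dtree \<Rightarrow> dtree" where
  "hd_tree Tip = Tip"
| "hd_tree (Bin l r) = l"

primrec tl_tree :: "dtree \<Rightarrow> dtree" where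
  "tl_tree Tip = Tip"
| "tl_tree (Bin l r) = r"

primrec val :: "expr \<Rightarrow> store \<Rightarrow> dtree" where
  "val (Var x) s = s x"
| "val Nul s = Tip"
| "val (Cns a b) s = Bin (val a s) (val b s)"
| "val (Hd a) s = hd_tree (val a s)"
| "val (Tl a) s = tl_tree (val a s)"

datatype com =
    Skip
  | Assign nat expr
  | Seq com com
  | Cond expr com com
  | While expr com

text \<open>\<open>exec c s t s'\<close>: started in \<open>s\<close>, program \<open>c\<close> halts in \<open>s'\<close> after time \<open>t\<close>.
  In tests, \<open>Tip\<close> is false and every other tree is true.\<close>

inductive exec :: "com \<Rightarrow> store \<Rightarrow> nat \<Rightarrow> store \<Rightarrow> bool" where
  Skip: "exec Skip s 1 s"
| Assign: "exec (Assign x a) s (1 + size (val a s)) (s(x := val a s))"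
| Seq: "exec c1 s t1 s' \<Longrightarrow> exec c2 s' t2 s'' \<Longrightarrow> exec (Seq c1 c2) s (t1 + t2) s''"
| CondTrue: "val a s \<noteq> Tip \<Longrightarrow> exec c1 s t s' \<Longrightarrow> exec (Cond a c1 c2) s (1 + t) s'"
| CondFalse: "val a s = Tip \<Longrightarrow> exec c2 s t s' \<Longrightarrow> exec (Cond a c1 c2) s (1 + t) s'"
| WhileFalse: "val a s = Tip \<Longrightarrow> exec (While a c) s 1 s"
| WhileTrue: "val a s \<noteq> Tip \<Longrightarrow> exec c s t1 s' \<Longrightarrow> exec (While a c) s' t2 s'' \<Longrightarrow>
    exec (While a c) s (1 + t1 + t2) s''"

text \<open>Input and output are passed in variable 0; all other variables start as \<open>Tip\<close>.\<close>

definition poly_time :: "(dtree \<Rightarrow> dtree) \<Rightarrow> bool" where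
  "poly_time f \<longleftrightarrow> (\<exists>c (q :: nat poly). \<forall>x. \<exists>t s.
     exec c ((\<lambda>_. Tip)(0 := x)) t s \<and> s 0 = f x \<and> t \<le> poly q (size x))"

definition enc_list :: "dtree list \<Rightarrow> dtree" where
  "enc_list ts = foldr Bin ts Tip"

definition enc_nat :: "nat \<Rightarrow> dtree" where
  "enc_nat n = enc_list (replicate n Tip)"

definition enc_bits :: "bool list \<Rightarrow> dtree" where
  "enc_bits bs = enc_list (map (\<lambda>b. if b then Bin Tip Tip else Tip) bs)"

definition enc_set :: "nat set \<Rightarrow> dtree" where
  "enc_set A = enc_list (map enc_nat (sorted_list_of_set A))"

text \<open>
  A randomized polynomial-time algorithm is a deterministic one that additionally reads a
  uniformly random bit string of polynomial length.  Deterministic algorithms are the special case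
  in which the bits are ignored.
\<close>

definition rand_poly_time :: "(dtree \<Rightarrow> dtree pmf) \<Rightarrow> bool" where
  "rand_poly_time A \<longleftrightarrow> (\<exists>f (q :: nat poly). poly_time f \<and>
     (\<forall>x. A x = map_pmf (\<lambda>bs. f (Bin x (enc_bits bs)))
                  (pmf_of_set {bs. length bs = poly q (size x)})))"


section \<open>The Hypergraph Dense-vs-Random Conjecture\<close>

text \<open>An \<open>r\<close>-uniform hypergraph on the vertex set \<open>{..<n}\<close> is identified with its edge set.\<close>

definition all_edges :: "nat \<Rightarrow> nat \<Rightarrow> nat set set" where
  "all_edges r n = {e. e \<subseteq> {..<n} \<and> card e = r}"

definition random_hypergraph :: "nat \<Rightarrow> nat \<Rightarrow> real \<Rightarrow> nat set set pmf" where
  "random_hypergraph r n p =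
     map_pmf (\<lambda>X. {e \<in> all_edges r n. X e}) (Pi_pmf (all_edges r n) False (\<lambda>_. bernoulli_pmf p))"

definition average_degree :: "nat set \<Rightarrow> nat set set \<Rightarrow> real" where
  "average_degree V E = (\<Sum>v\<in>V. real (card {e \<in> E. v \<in> e})) / real (card V)"

definition induced :: "nat set set \<Rightarrow> nat set \<Rightarrow> nat set set" where
  "induced E V = {e \<in> E. e \<subseteq> V}"

text \<open>Hypergraphs with a subhypergraph on \<open>k\<close> vertices of log-density at least \<open>\<beta>\<close>, that is,
  of average degree at least \<open>k powr \<beta>\<close>.\<close>

definition dense_hypergraphs :: "nat \<Rightarrow> nat \<Rightarrow> nat \<Rightarrow> real \<Rightarrow> nat set set set" where
  "dense_hypergraphs r n k \<beta> = {E. E \<subseteq> all_edges r n \<and>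
     (\<exists>V \<subseteq> {..<n}. card V = k \<and> average_degree V (induced E V) \<ge> real k powr \<beta>)}"

text \<open>The edges are listed in the order in which \<open>List.subseqs\<close> enumerates their sorted vertex lists.
  The planted size \<open>k\<close> is part of the input.\<close>

definition enc_hypergraph :: "nat \<Rightarrow> nat \<Rightarrow> nat set set \<Rightarrow> dtree" where
  "enc_hypergraph n k E = enc_list [enc_nat n, enc_nat k,
     enc_list (map (\<lambda>vs. enc_list (map enc_nat vs)) (filter (\<lambda>vs. set vs \<in> E) (List.subseqs [0..<n])))]"

text \<open>
  \<open>D\<close> solves Dense-vs-Random with log-density \<open>\<alpha>\<close> and planted subhypergraphs of size \<open>k n\<close> and
  log-density \<open>\<beta>\<close> with high probability.  The answer \<open>Tip\<close> means ``random'' and any other answer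
  ``dense''.  Edge probability \<open>n powr (\<alpha> - (r - 1))\<close> makes the average degree about
  \<open>n powr \<alpha>\<close>.  In the dense case the hypergraph is adversarial, so the probability is over the
  coins of \<open>D\<close> alone and the bound is uniform in the hypergraph.
\<close>

definition solves_dense_vs_random ::
  "nat \<Rightarrow> real \<Rightarrow> real \<Rightarrow> (nat \<Rightarrow> nat) \<Rightarrow> (dtree \<Rightarrow> dtree pmf) \<Rightarrow> bool" where
  "solves_dense_vs_random r \<alpha> \<beta> k D \<longleftrightarrow>
     (\<lambda>n. measure_pmf.prob
            (bind_pmf (random_hypergraph r n (real n powr (\<alpha> - (real r - 1))))
               (\<lambda>E. D (enc_hypergraph n (k n) E))) {Tip}) \<longlonglongrightarrow> 1 \<and>
     (\<forall>\<delta>>0. \<forall>\<^sub>F n in sequentially. \<forall>E \<in> dense_hypergraphs r n (k n) \<beta>.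
            measure_pmf.prob (D (enc_hypergraph n (k n) E)) (- {Tip}) \<ge> 1 - \<delta>)"

text \<open>
  The planted log-density is \<open>\<beta> = \<alpha> - \<epsilon>\<close>, and \<open>k\<close> grows polynomially.  The condition
  \<open>k powr (1 + \<beta>) \<le> n powr ((1 + \<alpha>) / 2)\<close> says that the planted part has at most about the
  square root of the number of edges of the random hypergraph.
\<close>

definition hypergraph_dense_vs_random_conjecture :: bool where
  "hypergraph_dense_vs_random_conjecture \<longleftrightarrow>
     (\<forall>r \<ge> 2. \<forall>\<alpha>. 0 < \<alpha> \<and> \<alpha> < real r - 1 \<longrightarrow>
       (\<exists>\<epsilon>0 > 0. \<forall>\<epsilon>. 0 < \<epsilon> \<and> \<epsilon> < \<epsilon>0 \<longrightarrow>
         (\<forall>k :: nat \<Rightarrow> nat.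
            (\<exists>c > 0. \<forall>\<^sub>F n in sequentially. real n powr c \<le> real (k n)) \<and>
            (\<forall>\<^sub>F n in sequentially.
               real (k n) powr (1 + (\<alpha> - \<epsilon>)) \<le> real n powr ((1 + \<alpha>) / 2)) \<longrightarrow>
            \<not> (\<exists>D. rand_poly_time D \<and> solves_dense_vs_random r \<alpha> (\<alpha> - \<epsilon>) k D))))"


section \<open>Red-Blue Set Cover\<close>

text \<open>The list \<open>fam I\<close> enumerates the collection of sets without repetition, so its length
  is the number of sets.\<close>

record rb_instance =
  red :: "nat set"
  blue :: "nat set"
  fam :: "nat set list"

definition rb_wf :: "rb_instance \<Rightarrow> bool" where
  "rb_wf I \<longleftrightarrow> finite (red I) \<and> finite (blue I) \<and> red I \<inter> blue I = {} \<and>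
     distinct (fam I) \<and> (\<forall>S \<in> set (fam I). S \<subseteq> red I \<union> blue I)"

definition rb_covers :: "rb_instance \<Rightarrow> nat set set set" where
  "rb_covers I = {F. F \<subseteq> set (fam I) \<and> blue I \<subseteq> \<Union>F}"

definition rb_cost :: "rb_instance \<Rightarrow> nat set set \<Rightarrow> nat" where
  "rb_cost I F = card (red I \<inter> \<Union>F)"

definition rb_opt :: "rb_instance \<Rightarrow> nat" where
  "rb_opt I = Min (rb_cost I ` rb_covers I)"

definition enc_instance :: "rb_instance \<Rightarrow> dtree" where
  "enc_instance I =
     enc_list [enc_set (red I), enc_set (blue I), enc_list (map enc_set (fam I))]"

text \<open>
  \<open>A\<close> is a \<open>\<rho>\<close>-approximation, where \<open>\<rho>\<close> depends on the number of sets and the number of blue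
  elements: on every feasible instance it outputs, with probability at least 2/3, a cover of cost
  at most \<open>\<rho>\<close> times the optimum.  (Independent repetition amplifies the constant 2/3.)
\<close>

definition rb_approximates :: "(dtree \<Rightarrow> dtree pmf) \<Rightarrow> (nat \<Rightarrow> nat \<Rightarrow> real) \<Rightarrow> bool" where
  "rb_approximates A \<rho> \<longleftrightarrow> (\<forall>I. rb_wf I \<and> rb_covers I \<noteq> {} \<longrightarrow>
     measure_pmf.prob (A (enc_instance I))
       {y. \<exists>Fs. y = enc_list (map enc_set Fs) \<and> set Fs \<in> rb_covers I \<and>
             real (rb_cost I (set Fs)) \<le> \<rho> (length (fam I)) (card (blue I)) * real (rb_opt I)}
     \<ge> 2 / 3)"

text \<open>
  The bound \<open>m powr (1/4 - \<epsilon>) / (ln k)\<^sup>2\<close>, read as an approximation ratio.  No ratio lies below 1,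
  whereas the formula does when \<open>k\<close> is superpolynomial in \<open>m\<close>; without the maximum
  such instances alone would rule out every algorithm, for trivial reasons.
\<close>

definition rb_ratio :: "real \<Rightarrow> nat \<Rightarrow> nat \<Rightarrow> real" where
  "rb_ratio \<epsilon> m k = max 1 (real m powr (1 / 4 - \<epsilon>) / (ln (real k))\<^sup>2)"

end

theory Submission
  imports Defs "HOL-Real_Asymp.Real_Asymp"
begin

text \<open>
  Fix a large \<open>c\<close>, put \<open>\<gamma> = 1/c\<close>, and consider hypergraphs of uniformity \<open>r = 3c\<close> and log-density
  \<open>\<alpha> = 1 + \<gamma>/2\<close> with planted parts on \<open>k = \<lfloor>\<surd>n\<rfloor>\<close> vertices.  Turn a hypergraph into a Red-Blue Set
  Cover instance: the vertices are red, the blue elements are \<open>L\<close> labels, where \<open>L\<close> is the least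
  power of 2 with \<open>n \<le> L\<close>, and every edge becomes a set by adding a uniformly random label.  Since
  each set has only one blue element, a cover uses at least \<open>n\<close> edges.

  In a random hypergraph a union bound shows that no \<open>n powr (1 - \<gamma>)\<close> vertices span \<open>n\<close> edges, so
  all covers are expensive, whatever the labels.  A planted part spans about \<open>k powr (2 + \<gamma>/4)\<close>
  edges, which is \<open>n\<close> times a power of \<open>n\<close>; hence with high probability its edges carry all labels,
  and the optimum is at most \<open>\<surd>n\<close>.  With at most \<open>n powr (2 + \<gamma>)\<close> sets (more edges than that
  never occur at random) a ratio of \<open>m powr (1/4 - \<epsilon>)\<close> then yields a cover of cost below
  \<open>n powr (1 - \<gamma>)\<close>.  The error is one-sided, so independent repetition makes it vanish.
\<close>

section \<open>Polynomial-time functions\<close>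

text \<open>Where the numbers come from: up to small powers of n, a planted part admits a cover of
  cost sqrt n, a random hypergraph admits none of cost below n, and there are n^2 sets; the gap sqrt
  n is the fourth root of the number of sets. The uniformity \<open>3 * c\<close> pays for the union
  bound: passing from n vertices to \<open>n powr (1 - \<gamma>)\<close> divides the expected number
  of edges by n^3 and leaves \<open>n powr (\<gamma> / 2 - 1)\<close>. Demanding n edges then has
  probability at most \<open>n powr ((\<gamma> / 2 - 1) * n)\<close> per vertex set, which beats the
  number \<open>2 ^ n\<close> of vertex sets. Hitting all L labels takes more than L edges by a
  logarithmic factor, which the planted surplus absorbs. The verdict rests on a checked witness and
  not on the algorithm's word: instances made from random hypergraphs may be infeasible, and there
  the approximation guarantee says nothing. Much of the length is owed to the concrete machine
  model: labelling, check and repetition must run in polynomial time on every tree, including trees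
  that encode nothing.\<close>

lemma poly_nat_mono: "x \<le> y \<Longrightarrow> poly (q :: nat poly) x \<le> poly q y"
  by (induction q) (auto intro!: add_mono mult_mono)

text \<open>An assignment pays for the whole tree it stores, so a time bound is also a bound on the
  size of the output. Composition depends on this, because the time of the second program is
  measured in the size of the first result.\<close>

lemma size_exec: "exec c s t s' \<Longrightarrow> size (s' v) \<le> size (s v) + t"
proof (induction arbitrary: v rule: exec.induct)
  case (Seq c1 s t1 s' c2 t2 s'')
  have "size (s'' v) \<le> size (s' v) + t2" "size (s' v) \<le> size (s v) + t1" using Seq by blast+
  then show ?case by linarith
next
  case (WhileTrue a s c t1 s' t2 s'')
  have "size (s'' v) \<le> size (s' v) + t2" "size (s' v) \<le> size (s v) + t1" using WhileTrue by blast+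
  then show ?case by linarith
next
  case (CondTrue a s c1 t s' c2)
  then show ?case by (metis add.left_commute le_add2 order_trans)
next
  case (CondFalse a s c2 t s' c1)
  then show ?case by (metis add.left_commute le_add2 order_trans)
qed auto

text \<open>A syntactic bound on the variables that occur, so that everything from \<open>N\<close>
  on is out of reach.\<close>

primrec expr_below :: "nat \<Rightarrow> expr \<Rightarrow> bool" where
  "expr_below N (Var x) \<longleftrightarrow> x < N"
| "expr_below N Nul \<longleftrightarrow> True"
| "expr_below N (Cns a b) \<longleftrightarrow> expr_below N a \<and> expr_below N b"
| "expr_below N (Hd a) \<longleftrightarrow> expr_below N a"
| "expr_below N (Tl a) \<longleftrightarrow> expr_below N a"

primrec com_below :: "nat \<Rightarrow> com \<Rightarrow> bool" where
  "com_below N Skip \<longleftrightarrow> True"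
| "com_below N (Assign x a) \<longleftrightarrow> x < N \<and> expr_below N a"
| "com_below N (Seq c d) \<longleftrightarrow> com_below N c \<and> com_below N d"
| "com_below N (Cond a c d) \<longleftrightarrow> expr_below N a \<and> com_below N c \<and> com_below N d"
| "com_below N (While a c) \<longleftrightarrow> expr_below N a \<and> com_below N c"

lemma expr_below_mono: "expr_below N a \<Longrightarrow> N \<le> M \<Longrightarrow> expr_below M a"
  by (induction a) auto

lemma com_below_mono: "com_below N c \<Longrightarrow> N \<le> M \<Longrightarrow> com_below M c"
  by (induction c) (auto intro: expr_below_mono)

lemma ex_expr_below: "\<exists>N. expr_below N a"
proof (induction a)
  case (Var x) then show ?case by (auto intro: exI[of _ "Suc x"])
next
  case (Cns a b)
  then obtain N M where "expr_below N a" "expr_below M b" by blast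
  then show ?case by (auto intro!: exI[of _ "max N M"] intro: expr_below_mono)
qed auto

lemma ex_com_below: "\<exists>N>0. com_below N c"
proof (induction c)
  case (Assign x a)
  obtain N where "expr_below N a" using ex_expr_below by blast
  then show ?case by (auto intro!: exI[of _ "max N (Suc x)"] intro: expr_below_mono)
next
  case (Seq c d)
  then obtain N M where "0 < N" "com_below N c" "com_below M d" by blast
  then show ?case by (auto intro!: exI[of _ "max N M"] intro: com_below_mono)
next
  case (Cond a c d)
  obtain K where "expr_below K a" using ex_expr_below by blast
  moreover obtain N M where "0 < N" "com_below N c" "com_below M d" using Cond by blast
  ultimately show ?case
    by (auto intro!: exI[of _ "max K (max N M)"] intro: com_below_mono expr_below_mono)
next
  case (While a c)
  obtain K where "expr_below K a" using ex_expr_below by blast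
  moreover obtain N where "0 < N" "com_below N c" using While by blast
  ultimately show ?case
    by (auto intro!: exI[of _ "max K N"] intro: com_below_mono expr_below_mono)
qed auto

lemma val_cong: "expr_below N a \<Longrightarrow> (\<And>i. i < N \<Longrightarrow> s i = s' i) \<Longrightarrow> val a s = val a s'"
  by (induction a) auto

text \<open>\<open>poly_time\<close> only describes runs that start with \<open>Tip\<close> in all
  variables but 0. A program below \<open>N\<close> cannot see the variables from \<open>N\<close>
  on, so the same run, in the same time, also takes place beside values saved there.\<close>

lemma exec_frame:
  "exec c s t s' \<Longrightarrow> com_below N c \<Longrightarrow> (\<And>i. i < N \<Longrightarrow> r i = s i) \<Longrightarrow>
     exec c r t (\<lambda>i. if i < N then s' i else r i)"
proof (induction arbitrary: r rule: exec.induct)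
  case (Skip s)
  have "(\<lambda>i. if i < N then s i else r i) = r" using Skip by auto
  then show ?case by (metis exec.Skip)
next
  case (Assign x a s)
  have v: "val a s = val a r" using Assign by (intro val_cong[of N]) auto
  have "(\<lambda>i. if i < N then (s(x := val a s)) i else r i) = r(x := val a r)"
    using Assign v by auto
  then show ?case using v by (metis exec.Assign)
next
  case (Seq c1 s t1 s' c2 t2 s'')
  let ?r = "\<lambda>i. if i < N then s' i else r i"
  have "exec c1 r t1 ?r" using Seq by simp
  moreover have "exec c2 ?r t2 (\<lambda>i. if i < N then s'' i else ?r i)" using Seq by simp
  moreover have "(\<lambda>i. if i < N then s'' i else ?r i) = (\<lambda>i. if i < N then s'' i else r i)" by auto
  ultimately show ?case by (metis exec.Seq)
next
  case (CondTrue a s c1 t s' c2)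
  then have "val a r \<noteq> Tip" using val_cong[of N a r s] by auto
  then show ?case using CondTrue by (intro exec.CondTrue) auto
next
  case (CondFalse a s c2 t s' c1)
  then have "val a r = Tip" using val_cong[of N a r s] by auto
  then show ?case using CondFalse by (intro exec.CondFalse) auto
next
  case (WhileFalse a s c)
  then have "val a r = Tip" using val_cong[of N a r s] by auto
  moreover have "(\<lambda>i. if i < N then s i else r i) = r" using WhileFalse by auto
  ultimately show ?case by (metis exec.WhileFalse)
next
  case (WhileTrue a s c t1 s' t2 s'')
  let ?r = "\<lambda>i. if i < N then s' i else r i"
  have "val a r \<noteq> Tip" using WhileTrue val_cong[of N a r s] by auto
  moreover have "exec c r t1 ?r" using WhileTrue by simp
  moreover have "exec (While a c) ?r t2 (\<lambda>i. if i < N then s'' i else ?r i)" using WhileTrue by simp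
  moreover have "(\<lambda>i. if i < N then s'' i else ?r i) = (\<lambda>i. if i < N then s'' i else r i)" by auto
  ultimately show ?case by (metis exec.WhileTrue)
qed

section \<open>Tidy programs and their composition\<close>

text \<open>Unlike programs in general, tidy ones compose: they leave their scratch variables clean and do
  not touch the variables above them.\<close>

definition tidy :: "com \<Rightarrow> nat \<Rightarrow> (dtree \<Rightarrow> dtree) \<Rightarrow> nat poly \<Rightarrow> bool" where
  "tidy c N f q \<longleftrightarrow> (\<forall>s. (\<forall>i. 0 < i \<and> i < N \<longrightarrow> s i = Tip) \<longrightarrow>
     (\<exists>t \<le> poly q (size (s 0)). exec c s t (s(0 := f (s 0)))))"

lemma tidy_mono: "tidy c N f q \<Longrightarrow> N \<le> M \<Longrightarrow> tidy c M f q"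
  unfolding tidy_def by (meson less_le_trans)

lemma exec_clear:
  "exec (foldr (\<lambda>i. Seq (Assign i Nul)) is Skip) s (Suc (length is)) (\<lambda>i. if i \<in> set is then Tip else s i)"
proof (induction "is" arbitrary: s)
  case Nil
  show ?case using exec.Skip[of s] by simp
next
  case (Cons j js)
  have "exec (Assign j Nul) s 1 (s(j := Tip))"
    using exec.Assign[of j Nul s] by simp
  from exec.Seq[OF this Cons.IH]
  have "exec (foldr (\<lambda>i. Seq (Assign i Nul)) (j # js) Skip) s (Suc (length (j # js)))
      (\<lambda>i. if i \<in> set js then Tip else (s(j := Tip)) i)" by simp
  moreover have "(\<lambda>i. if i \<in> set js then Tip else (s(j := Tip)) i) = (\<lambda>i. if i \<in> set (j # js) then Tip else s i)"
    by auto
  ultimately show ?case by simp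
qed

text \<open>Any program becomes tidy by resetting its scratch variables at the end. That takes
  \<open>N - 1\<close> assignments of cost 1 and a final \<open>Skip\<close>, hence the constant
  \<open>[:N:]\<close>.\<close>

lemma poly_time_iff_tidy: "poly_time f \<longleftrightarrow> (\<exists>c N q. tidy c N f q)"
proof
  assume "poly_time f"
  then obtain c q where c: "\<And>x. \<exists>t s. exec c ((\<lambda>_. Tip)(0 := x)) t s \<and> s 0 = f x \<and> t \<le> poly q (size x)"
    unfolding poly_time_def by blast
  obtain N where N: "N > 0" "com_below N c" using ex_com_below by blast
  let ?c = "Seq c (foldr (\<lambda>i. Seq (Assign i Nul)) [1..<N] Skip)"
  have "tidy ?c N f (q + [:N:])"
    unfolding tidy_def
  proof (intro allI impI)
    fix s :: store
    assume s: "\<forall>i. 0 < i \<and> i < N \<longrightarrow> s i = Tip"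
    obtain t s' where e: "exec c ((\<lambda>_. Tip)(0 := s 0)) t s'" "s' 0 = f (s 0)" "t \<le> poly q (size (s 0))"
      using c by blast
    let ?s = "\<lambda>i. if i < N then s' i else s i"
    have "exec c s t ?s"
      using s by (intro exec_frame[OF e(1) N(2)]) auto
    from exec.Seq[OF this exec_clear[of "[1..<N]"]]
    have "exec ?c s (t + N) (\<lambda>i. if i \<in> set [1..<N] then Tip else ?s i)" using N by simp
    moreover have "(\<lambda>i. if i \<in> set [1..<N] then Tip else ?s i) = s(0 := f (s 0))"
      using s e(2) N(1) by (auto simp: fun_eq_iff)
    ultimately show "\<exists>t \<le> poly (q + [:N:]) (size (s 0)). exec ?c s t (s(0 := f (s 0)))"
      using e(3) by (intro exI[of _ "t + N"]) auto
  qed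
  then show "\<exists>c N q. tidy c N f q" by blast
next
  assume "\<exists>c N q. tidy c N f q"
  then obtain c N q where c: "tidy c N f q" by blast
  have "\<exists>t s. exec c ((\<lambda>_. Tip)(0 := x)) t s \<and> s 0 = f x \<and> t \<le> poly q (size x)" for x
    using c[unfolded tidy_def, rule_format, of "(\<lambda>_. Tip)(0 := x)"]
    by (auto intro!: exI[of _ "((\<lambda>_. Tip)(0 := x))(0 := f x)"])
  then show "poly_time f" unfolding poly_time_def by blast
qed

lemma tidy_size: 
  assumes "tidy c N f q" shows "size (f x) \<le> size x + poly q (size x)"
proof -
  obtain t where t: "t \<le> poly q (size x)" "exec c ((\<lambda>_. Tip)(0 := x)) t (((\<lambda>_. Tip)(0 := x))(0 := f x))"
    using assms[unfolded tidy_def, rule_format, of "(\<lambda>_. Tip)(0 := x)"] by auto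
  from size_exec[OF t(2), of 0] t(1) show ?thesis by simp
qed

lemma poly_time_size:
  assumes "poly_time f"
  obtains q :: "nat poly" where "\<And>x. size (f x) \<le> poly q (size x)"
proof -
  obtain c N q where "tidy c N f q" using assms poly_time_iff_tidy by blast
  from tidy_size[OF this] show ?thesis by (intro that[of "[:0,1:] + q"]) simp
qed

text \<open>The intermediate value has size at most input size plus running time, hence the
  substitution of \<open>[:0,1:] + p\<close> into the second bound.\<close>

lemma poly_time_comp:
  assumes "poly_time f" "poly_time g" shows "poly_time (\<lambda>x. f (g x))"
proof -
  obtain c N q where f0: "tidy c N f q" using assms poly_time_iff_tidy by blast
  obtain d M p where g0: "tidy d M g p" using assms poly_time_iff_tidy by blast
  let ?N = "max N M"
  have f: "tidy c ?N f q" and g: "tidy d ?N g p" using f0 g0 tidy_mono by auto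
  have "tidy (Seq d c) ?N (\<lambda>x. f (g x)) (p + pcompose q ([:0,1:] + p))"
    unfolding tidy_def
  proof (intro allI impI)
    fix s :: store
    assume s: "\<forall>i. 0 < i \<and> i < ?N \<longrightarrow> s i = Tip"
    obtain t where t: "t \<le> poly p (size (s 0))" "exec d s t (s(0 := g (s 0)))"
      using g s unfolding tidy_def by blast
    have "\<forall>i. 0 < i \<and> i < ?N \<longrightarrow> (s(0 := g (s 0))) i = Tip" using s by auto
    then obtain u where u: "u \<le> poly q (size (g (s 0)))" "exec c (s(0 := g (s 0))) u (s(0 := f (g (s 0))))"
      using f[unfolded tidy_def, rule_format, of "s(0 := g (s 0))"] by auto
    have "u \<le> poly q (size (s 0) + poly p (size (s 0)))"
      using u(1) poly_nat_mono[OF tidy_size[OF g], of q "s 0"] by linarith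
    then show "\<exists>t \<le> poly (p + pcompose q ([:0,1:] + p)) (size (s 0)). exec (Seq d c) s t (s(0 := f (g (s 0))))"
      using exec.Seq[OF t(2) u(2)] t(1) by (intro exI[of _ "t + u"]) (auto simp: poly_pcompose)
  qed
  then show ?thesis using poly_time_iff_tidy by blast
qed

section \<open>Elementary programs: constants, pairing, branching, loops\<close>

lemma poly_time_id: "poly_time (\<lambda>x. x)"
proof -
  have "tidy Skip 0 (\<lambda>x. x) [:1:]"
    unfolding tidy_def using exec.Skip by (auto intro!: exI[of _ 1])
  then show ?thesis using poly_time_iff_tidy by blast
qed

primrec const_expr :: "dtree \<Rightarrow> expr" where
  "const_expr Tip = Nul"
| "const_expr (Bin l r) = Cns (const_expr l) (const_expr r)"

lemma val_const_expr: "val (const_expr t) s = t"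
  by (induction t) auto

lemma poly_time_assign:
  assumes "\<And>s. val e s = f (s 0)" "\<And>x. size (f x) \<le> size x + b"
  shows "poly_time f"
proof -
  have "tidy (Assign 0 e) 0 f [:1 + b, 1:]"
    unfolding tidy_def
  proof (intro allI impI)
    fix s :: store
    show "\<exists>t \<le> poly [:1 + b, 1:] (size (s 0)). exec (Assign 0 e) s t (s(0 := f (s 0)))"
      using exec.Assign[of 0 e s] assms(2)[of "s 0"] unfolding assms(1)
      by (intro exI[of _ "1 + size (f (s 0))"]) auto
  qed
  then show ?thesis using poly_time_iff_tidy by blast
qed

lemma poly_time_const: "poly_time (\<lambda>_. t)"
  by (rule poly_time_assign[of "const_expr t" _ "size t"]) (auto simp: val_const_expr)

lemma size_hd_tree: "size (hd_tree t) \<le> size t" by (cases t) auto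
lemma size_tl_tree: "size (tl_tree t) \<le> size t" by (cases t) auto

lemma poly_time_hd: "poly_time f \<Longrightarrow> poly_time (\<lambda>x. hd_tree (f x))"
  by (rule poly_time_comp[of hd_tree], rule poly_time_assign[of "Hd (Var 0)" _ 0])
     (auto simp: size_hd_tree)

lemma poly_time_tl: "poly_time f \<Longrightarrow> poly_time (\<lambda>x. tl_tree (f x))"
  by (rule poly_time_comp[of tl_tree], rule poly_time_assign[of "Tl (Var 0)" _ 0])
     (auto simp: size_tl_tree)

text \<open>Both programs have to start from the input in variable 0. Two variables above their
  scratch space hold a copy of the input and the first result meanwhile.\<close>

lemma poly_time_Bin:
  assumes "poly_time f" "poly_time g" shows "poly_time (\<lambda>x. Bin (f x) (g x))"
proof -
  obtain c N q where f0: "tidy c N f q" using assms poly_time_iff_tidy by blast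
  obtain d M p where g0: "tidy d M g p" using assms poly_time_iff_tidy by blast
  \<comment> \<open>\<open>Suc\<close> keeps \<open>K\<close> distinct from 0, the variable of input
    and output.\<close>
  define K where "K = Suc (max N M)"
  have f: "tidy c K f q" and g: "tidy d K g p" 
    using tidy_mono[OF f0, of K] tidy_mono[OF g0, of K] by (auto simp: K_def)
  let ?c = "Seq (Assign K (Var 0)) (Seq c (Seq (Assign (K+1) (Var 0)) (Seq (Assign 0 (Var K)) (Seq d
     (Seq (Assign 0 (Cns (Var (K+1)) (Var 0))) (Seq (Assign K Nul) (Assign (K+1) Nul)))))))"
  \<comment> \<open>The coefficients add up the costs of the eight commands, with
    \<open>size (f x)\<close> and \<open>size (g x)\<close> bounded through
    \<open>tidy_size\<close>.\<close>
  have "tidy ?c (K+2) (\<lambda>x. Bin (f x) (g x)) ([:7,5:] + smult 3 q + smult 2 p)"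
    unfolding tidy_def
  proof (intro allI impI)
    fix s :: store
    assume s: "\<forall>i. 0 < i \<and> i < K + 2 \<longrightarrow> s i = Tip"
    have K: "K \<noteq> 0" by (simp add: K_def)
    define x where "x = s 0"
    obtain t where t: "t \<le> poly q (size x)" "exec c (s(K := x)) t (s(K := x, 0 := f x))"
      using f[unfolded tidy_def, rule_format, of "s(K := x)"] s K by (auto simp: x_def)
    obtain u where u: "u \<le> poly p (size x)"
      "exec d (s(K := x, 0 := f x, K + 1 := f x, 0 := x)) u (s(K := x, 0 := f x, K + 1 := f x, 0 := x, 0 := g x))"
      using g[unfolded tidy_def, rule_format, of "s(K := x, 0 := f x, K + 1 := f x, 0 := x)"] s K by auto
    have a1: "exec (Assign K (Var 0)) s (1 + size x) (s(K := x))"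
      using exec.Assign[of K "Var 0" s] by (simp add: x_def)
    have a2: "exec (Assign (K+1) (Var 0)) (s(K := x, 0 := f x)) (1 + size (f x)) (s(K := x, 0 := f x, K + 1 := f x))"
      using exec.Assign[of "K+1" "Var 0" "s(K := x, 0 := f x)"] by simp
    have a3: "exec (Assign 0 (Var K)) (s(K := x, 0 := f x, K + 1 := f x)) (1 + size x)
        (s(K := x, 0 := f x, K + 1 := f x, 0 := x))"
      using exec.Assign[of 0 "Var K" "s(K := x, 0 := f x, K + 1 := f x)"] K by simp
    let ?s4 = "s(K := x, 0 := f x, K + 1 := f x, 0 := x, 0 := g x)"
    have a4: "exec (Assign 0 (Cns (Var (K+1)) (Var 0))) ?s4 (1 + size (Bin (f x) (g x))) 
       (?s4(0 := Bin (f x) (g x)))"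
      using exec.Assign[of 0 "Cns (Var (K+1)) (Var 0)" ?s4] K by simp
    have a5: "exec (Seq (Assign K Nul) (Assign (K+1) Nul)) (?s4(0 := Bin (f x) (g x))) (1 + 1)
       (?s4(0 := Bin (f x) (g x), K := Tip, K + 1 := Tip))"
      using exec.Seq[OF exec.Assign[of K Nul "?s4(0 := Bin (f x) (g x))"] exec.Assign[of "K+1" Nul]] by simp
    have fin: "?s4(0 := Bin (f x) (g x), K := Tip, K + 1 := Tip) = s(0 := Bin (f x) (g x))"
      using s K by (auto simp: fun_eq_iff)
    note E = exec.Seq[OF a1 exec.Seq[OF t(2) exec.Seq[OF a2 exec.Seq[OF a3 exec.Seq[OF u(2)
      exec.Seq[OF a4 a5[unfolded fin]]]]]]]
    show "\<exists>t \<le> poly ([:7,5:] + smult 3 q + smult 2 p) (size (s 0)). exec ?c s t (s(0 := Bin (f (s 0)) (g (s 0))))"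
      unfolding x_def[symmetric]
      by (rule exI, rule conjI[rotated], rule E)
        (use t(1) u(1) tidy_size[OF f, of x] tidy_size[OF g, of x] in \<open>simp add: algebra_simps\<close>)
  qed
  then show ?thesis using poly_time_iff_tidy by blast
qed

text \<open>The test overwrites variable 0, so its value moves to \<open>K + 1\<close> and the saved
  input returns to variable 0 before either branch starts.\<close>

lemma poly_time_if_Tip:
  assumes "poly_time b" "poly_time f" "poly_time g"
  shows "poly_time (\<lambda>x. if b x = Tip then f x else g x)"
proof -
  obtain c N q where f0: "tidy c N f q" using assms poly_time_iff_tidy by blast
  obtain d M p where g0: "tidy d M g p" using assms poly_time_iff_tidy by blast
  obtain e L o' where b0: "tidy e L b o'" using assms poly_time_iff_tidy by blast
  define K where "K = Suc (max (max N M) L)"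
  have f: "tidy c K f q" and g: "tidy d K g p" and b: "tidy e K b o'"
    using tidy_mono[OF f0, of K] tidy_mono[OF g0, of K] tidy_mono[OF b0, of K] by (auto simp: K_def)
  let ?h = "\<lambda>x. if b x = Tip then f x else g x"
  let ?c = "Seq (Assign K (Var 0)) (Seq e (Seq (Assign (K+1) (Var 0)) (Seq (Assign 0 (Var K)) 
     (Seq (Cond (Var (K+1)) d c) (Seq (Assign K Nul) (Assign (K+1) Nul))))))"
  have "tidy ?c (K+2) ?h ([:7,3:] + q + p + smult 2 o')"
    unfolding tidy_def
  proof (intro allI impI)
    fix s :: store
    assume s: "\<forall>i. 0 < i \<and> i < K + 2 \<longrightarrow> s i = Tip"
    have K: "K \<noteq> 0" by (simp add: K_def)
    define x where "x = s 0"
    obtain t where t: "t \<le> poly o' (size x)" "exec e (s(K := x)) t (s(K := x, 0 := b x))"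
      using b[unfolded tidy_def, rule_format, of "s(K := x)"] s K by (auto simp: x_def)
    have a1: "exec (Assign K (Var 0)) s (1 + size x) (s(K := x))"
      using exec.Assign[of K "Var 0" s] by (simp add: x_def)
    have a2: "exec (Assign (K+1) (Var 0)) (s(K := x, 0 := b x)) (1 + size (b x)) (s(K := x, 0 := b x, K + 1 := b x))"
      using exec.Assign[of "K+1" "Var 0" "s(K := x, 0 := b x)"] by simp
    let ?s3 = "s(K := x, 0 := b x, K + 1 := b x, 0 := x)"
    have a3: "exec (Assign 0 (Var K)) (s(K := x, 0 := b x, K + 1 := b x)) (1 + size x) ?s3"
      using exec.Assign[of 0 "Var K" "s(K := x, 0 := b x, K + 1 := b x)"] K by simp
    have "\<exists>u \<le> poly q (size x) + poly p (size x). exec (Cond (Var (K+1)) d c) ?s3 (1 + u) (?s3(0 := ?h x))"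
    proof (cases "b x = Tip")
      case True
      obtain u where "u \<le> poly q (size x)" "exec c ?s3 u (?s3(0 := f x))"
        using f[unfolded tidy_def, rule_format, of ?s3] s K by auto
      then show ?thesis using exec.CondFalse[of "Var (K+1)" ?s3 c u _ d] True 
        by (intro exI[of _ u]) auto
    next
      case False
      obtain u where "u \<le> poly p (size x)" "exec d ?s3 u (?s3(0 := g x))"
        using g[unfolded tidy_def, rule_format, of ?s3] s K by auto
      then show ?thesis using exec.CondTrue[of "Var (K+1)" ?s3 d u _ c] False 
        by (intro exI[of _ u]) auto
    qed
    then obtain u where u: "u \<le> poly q (size x) + poly p (size x)"
      "exec (Cond (Var (K+1)) d c) ?s3 (1 + u) (?s3(0 := ?h x))" by blast
    have a5: "exec (Seq (Assign K Nul) (Assign (K+1) Nul)) (?s3(0 := ?h x)) (1 + 1)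
       (?s3(0 := ?h x, K := Tip, K + 1 := Tip))"
      using exec.Seq[OF exec.Assign[of K Nul "?s3(0 := ?h x)"] exec.Assign[of "K+1" Nul]] by simp
    have fin: "?s3(0 := ?h x, K := Tip, K + 1 := Tip) = s(0 := ?h x)"
      using s K by (auto simp: fun_eq_iff)
    note E = exec.Seq[OF a1 exec.Seq[OF t(2) exec.Seq[OF a2 exec.Seq[OF a3 exec.Seq[OF u(2) a5[unfolded fin]]]]]]
    show "\<exists>t \<le> poly ([:7,3:] + q + p + smult 2 o') (size (s 0)). exec ?c s t (s(0 := ?h (s 0)))"
      unfolding x_def[symmetric]
      by (rule exI, rule conjI[rotated], rule E)
        (use t(1) u(1) tidy_size[OF b, of x] in \<open>simp add: algebra_simps\<close>)
  qed
  then show ?thesis using poly_time_iff_tidy by blast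
qed

text \<open>A step that runs in polynomial time may still grow its argument exponentially under
  iteration. The invariant therefore bounds every state by a polynomial in the original input
  \<open>x\<close>, while \<open>\<mu>\<close> bounds the number of rounds. The head of the state is
  the loop condition.\<close>

lemma poly_time_while:
  fixes p :: "nat poly" and \<mu> :: "dtree \<Rightarrow> nat"
  assumes "poly_time init" "poly_time step"
    and init: "\<And>x. Inv x (init x)"
    and step: "\<And>x y. Inv x y \<Longrightarrow> hd_tree y \<noteq> Tip \<Longrightarrow> Inv x (step y) \<and> \<mu> (step y) < \<mu> y"
    and bound: "\<And>x y. Inv x y \<Longrightarrow> size y \<le> poly p (size x)" "\<And>x. \<mu> (init x) \<le> poly p (size x)"
    and final: "\<And>x y. Inv x y \<Longrightarrow> hd_tree y = Tip \<Longrightarrow> y = f x"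
  shows "poly_time f"
proof -
  obtain c N q where i0: "tidy c N init q" using assms poly_time_iff_tidy by blast
  obtain d M o' where s0: "tidy d M step o'" using assms poly_time_iff_tidy by blast
  define K where "K = max N M"
  have i: "tidy c K init q" and st: "tidy d K step o'"
    using tidy_mono[OF i0, of K] tidy_mono[OF s0, of K] by (auto simp: K_def)
  let ?w = "While (Hd (Var 0)) d"
  have loop: "\<exists>t \<le> 1 + \<mu> y * (1 + poly o' (poly p (size x))). exec ?w (s(0 := y)) t (s(0 := f x))"
    if "Inv x y" "\<forall>i. 0 < i \<and> i < K \<longrightarrow> s i = Tip" for x y s
    using that
  proof (induction "\<mu> y" arbitrary: y rule: less_induct)
    case less
    show ?case
    proof (cases "hd_tree y = Tip")
      case True
      then have "y = f x" using final less by blast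
      then show ?thesis using exec.WhileFalse[of "Hd (Var 0)" "s(0 := y)" d] True
        by (intro exI[of _ 1]) auto
    next
      case False
      note S = step[OF less(2) False]
      obtain u where u: "u \<le> poly o' (size y)" "exec d (s(0 := y)) u (s(0 := step y))"
        using st[unfolded tidy_def, rule_format, of "s(0 := y)"] less(3) by auto
      obtain t where t: "t \<le> 1 + \<mu> (step y) * (1 + poly o' (poly p (size x)))"
        "exec ?w (s(0 := step y)) t (s(0 := f x))" using less(1) S less(3) by blast
      have "exec ?w (s(0 := y)) (1 + u + t) (s(0 := f x))"
        using False by (intro exec.WhileTrue[OF _ u(2) t(2)]) simp
      moreover have "u \<le> poly o' (poly p (size x))"
        using u(1) poly_nat_mono[OF bound(1)[OF less(2)], of o'] by linarith
      moreover have "(1 + \<mu> (step y)) * (1 + poly o' (poly p (size x))) \<le> \<mu> y * (1 + poly o' (poly p (size x)))"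
        using S by (intro mult_right_mono) auto
      ultimately show ?thesis using t(1) by (intro exI[of _ "1 + u + t"]) auto
    qed
  qed
  have "tidy (Seq c ?w) K f (q + 1 + p * (1 + pcompose o' p))"
    unfolding tidy_def
  proof (intro allI impI)
    fix s :: store
    assume s: "\<forall>i. 0 < i \<and> i < K \<longrightarrow> s i = Tip"
    obtain t where t: "t \<le> poly q (size (s 0))" "exec c s t (s(0 := init (s 0)))"
      using i s unfolding tidy_def by blast
    obtain u where u: "u \<le> 1 + \<mu> (init (s 0)) * (1 + poly o' (poly p (size (s 0))))"
      "exec ?w (s(0 := init (s 0))) u (s(0 := f (s 0)))"
      using loop[OF init s] by blast
    have "\<mu> (init (s 0)) * (1 + poly o' (poly p (size (s 0)))) \<le> poly p (size (s 0)) * (1 + poly o' (poly p (size (s 0))))"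
      by (intro mult_right_mono bound) auto
    then show "\<exists>t \<le> poly (q + 1 + p * (1 + pcompose o' p)) (size (s 0)). exec (Seq c ?w) s t (s(0 := f (s 0)))"
      using exec.Seq[OF t(2) u(2)] t(1) u(1) by (intro exI[of _ "t + u"]) (auto simp: poly_pcompose)
  qed
  then show ?thesis using poly_time_iff_tidy by blast
qed

section \<open>Trees as lists\<close>

text \<open>Inverse of \<open>enc_list\<close>. Every tree is a list along its right spine, so
  decoding is total and programs on lists need no well-formedness assumption.\<close>

primrec dl :: "dtree \<Rightarrow> dtree list" where
  "dl Tip = []"
| "dl (Bin a t) = a # dl t"

lemma dl_enc_list [simp]: "dl (enc_list ts) = ts"
  by (induction ts) (auto simp: enc_list_def)

lemma enc_list_dl [simp]: "enc_list (dl t) = t"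
  by (induction t) (auto simp: enc_list_def)

lemma enc_list_simps [simp]: "enc_list [] = Tip" "enc_list (a # ts) = Bin a (enc_list ts)"
  by (auto simp: enc_list_def)

lemma dl_tl_tree [simp]: "dl (tl_tree t) = tl (dl t)"
  by (cases t) auto

lemma dl_eq_Nil [simp]: "dl t = [] \<longleftrightarrow> t = Tip"
  by (cases t) auto

lemma dl_inject: "dl s = dl t \<longleftrightarrow> s = t"
  by (metis enc_list_dl)

lemma size_eq_dl: "size t = length (dl t) + sum_list (map size (dl t))"
  by (induction t) auto

lemma size_enc_list: "size (enc_list ts) = length ts + sum_list (map size ts)"
  by (simp add: size_eq_dl)

lemma size_enc_nat [simp]: "size (enc_nat n) = n"
  by (simp add: enc_nat_def size_enc_list sum_list_replicate)

lemma length_dl_le: "length (dl t) \<le> size t"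
  by (simp add: size_eq_dl)

lemma size_mem_dl: "a \<in> set (dl t) \<Longrightarrow> size a < size t"
  by (induction t) auto

lemma dl_enc_nat [simp]: "dl (enc_nat n) = replicate n Tip"
  by (simp add: enc_nat_def)

lemma enc_nat_Suc: "enc_nat (Suc n) = Bin Tip (enc_nat n)" and enc_nat_0 [simp]: "enc_nat 0 = Tip"
  by (simp_all add: enc_nat_def)

text \<open>The loop state consists of the remaining list, the input and the accumulator. The size
  bound covers all prefixes because each of them occurs as a state.\<close>

lemma poly_time_fold:
  fixes p :: "nat poly"
  assumes "poly_time s" "poly_time g"
    and H: "poly_time (\<lambda>y. H (hd_tree y) (hd_tree (tl_tree y)) (tl_tree (tl_tree y)))"
    and bound: "\<And>x i. i \<le> length (dl (s x)) \<Longrightarrow> size (fold (H x) (take i (dl (s x))) (g x)) \<le> poly p (size x)"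
  shows "poly_time (\<lambda>x. fold (H x) (dl (s x)) (g x))"
proof -
  obtain q where q: "\<And>x. size (s x) \<le> poly q (size x)" using poly_time_size[OF assms(1)] by blast
  \<comment> \<open>The last loop state: the list is used up and the result sits behind the saved
    input.\<close>
  define R where "R x = Bin Tip (Bin x (fold (H x) (dl (s x)) (g x)))" for x
  have "poly_time R"
  proof (rule poly_time_while[where init = "\<lambda>x. Bin (s x) (Bin x (g x))"
      and step = "\<lambda>y. Bin (tl_tree (hd_tree y)) (Bin (hd_tree (tl_tree y)) 
                (H (hd_tree (tl_tree y)) (hd_tree (hd_tree y)) (tl_tree (tl_tree y))))"
      and Inv = "\<lambda>x y. \<exists>i \<le> length (dl (s x)). 
            y = Bin (enc_list (drop i (dl (s x)))) (Bin x (fold (H x) (take i (dl (s x))) (g x)))"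
      and \<mu> = "\<lambda>y. length (dl (hd_tree y))" and p = "q + [:2,1:] + p"])
    have "poly_time (\<lambda>y. (\<lambda>y. H (hd_tree y) (hd_tree (tl_tree y)) (tl_tree (tl_tree y)))
        (Bin (hd_tree (tl_tree y)) (Bin (hd_tree (hd_tree y)) (tl_tree (tl_tree y)))))"
      by (intro poly_time_comp[OF H] poly_time_Bin poly_time_hd poly_time_tl poly_time_id)
    then show "poly_time (\<lambda>y. Bin (tl_tree (hd_tree y)) (Bin (hd_tree (tl_tree y)) 
                (H (hd_tree (tl_tree y)) (hd_tree (hd_tree y)) (tl_tree (tl_tree y)))))"
      by (intro poly_time_Bin poly_time_hd poly_time_tl poly_time_id) simp
    show "poly_time (\<lambda>x. Bin (s x) (Bin x (g x)))"
      by (intro poly_time_Bin assms poly_time_id)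
    show "\<exists>i \<le> length (dl (s x)). Bin (s x) (Bin x (g x)) = 
         Bin (enc_list (drop i (dl (s x)))) (Bin x (fold (H x) (take i (dl (s x))) (g x)))" for x
      by (rule exI[of _ 0]) auto
    show "length (dl (hd_tree (Bin (s x) (Bin x (g x))))) \<le> poly (q + [:2,1:] + p) (size x)" for x
      using q[of x] length_dl_le[of "s x"] by simp
    fix x y
    assume "\<exists>i \<le> length (dl (s x)). y = Bin (enc_list (drop i (dl (s x)))) (Bin x (fold (H x) (take i (dl (s x))) (g x)))"
    then obtain i where i: "i \<le> length (dl (s x))"
       "y = Bin (enc_list (drop i (dl (s x)))) (Bin x (fold (H x) (take i (dl (s x))) (g x)))" by blast
    have "sum_list (map size (drop i (dl (s x)))) \<le> sum_list (map size (dl (s x)))"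
      by (metis append_take_drop_id le_add2 map_append sum_list_append)
    then have "size (enc_list (drop i (dl (s x)))) \<le> poly q (size x)"
      using q[of x] by (simp add: size_enc_list size_eq_dl[of "s x"])
    then show "size y \<le> poly (q + [:2,1:] + p) (size x)"
      using bound[OF i(1)] i by simp
    show "y = R x" if "hd_tree y = Tip"
      using that i by (auto simp: R_def simp flip: dl_eq_Nil)
    assume "hd_tree y \<noteq> Tip"
    then have lt: "i < length (dl (s x))" using i by (auto simp flip: dl_eq_Nil)
    then have d: "drop i (dl (s x)) = dl (s x) ! i # drop (Suc i) (dl (s x))"
      by (simp add: Cons_nth_drop_Suc)
    show "(\<exists>i \<le> length (dl (s x)). Bin (tl_tree (hd_tree y)) (Bin (hd_tree (tl_tree y)) 
                (H (hd_tree (tl_tree y)) (hd_tree (hd_tree y)) (tl_tree (tl_tree y)))) =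
        Bin (enc_list (drop i (dl (s x)))) (Bin x (fold (H x) (take i (dl (s x))) (g x)))) \<and>
      length (dl (hd_tree (Bin (tl_tree (hd_tree y)) (Bin (hd_tree (tl_tree y)) 
                (H (hd_tree (tl_tree y)) (hd_tree (hd_tree y)) (tl_tree (tl_tree y))))))) < length (dl (hd_tree y))"
      using lt unfolding i(2) d by (auto intro!: exI[of _ "Suc i"] simp: take_Suc_conv_app_nth)
  qed
  from poly_time_tl[OF poly_time_tl[OF this]] show ?thesis by (simp add: R_def)
qed

text \<open>If a round adds an amount independent of the accumulator, the total growth is at most
  the length of the list times that amount.\<close>

lemma poly_time_fold_additive:
  fixes p :: "nat poly"
  assumes "poly_time s" "poly_time g"
    and H: "poly_time (\<lambda>y. H (hd_tree y) (hd_tree (tl_tree y)) (tl_tree (tl_tree y)))"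
    and bound: "\<And>x a acc. size (H x a acc) \<le> size acc + poly p (size x + size a)"
  shows "poly_time (\<lambda>x. fold (H x) (dl (s x)) (g x))"
proof -
  obtain q where q: "\<And>x. size (s x) \<le> poly q (size x)" using poly_time_size[OF assms(1)] by blast
  obtain r where r: "\<And>x. size (g x) \<le> poly r (size x)" using poly_time_size[OF assms(2)] by blast
  have *: "size (fold (H x) as acc) \<le> size acc + length as * poly p (size x + b)" 
    if "\<And>a. a \<in> set as \<Longrightarrow> size a \<le> b" for x as acc b
    using that
  proof (induction as arbitrary: acc)
    case (Cons a as)
    have "size (fold (H x) as (H x a acc)) \<le> size (H x a acc) + length as * poly p (size x + b)"
      using Cons by auto
    moreover have "size (H x a acc) \<le> size acc + poly p (size x + b)"
      using bound[of x a acc] poly_nat_mono[of "size x + size a" "size x + b" p] Cons.prems[of a] by simp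
    ultimately show ?case by simp
  qed simp
  show ?thesis
  proof (rule poly_time_fold[OF assms(1,2) H, where p = "r + q * pcompose p ([:0,1:] + q)"])
    fix x i
    assume i: "i \<le> length (dl (s x))"
    have "size (fold (H x) (take i (dl (s x))) (g x)) \<le> 
        size (g x) + length (take i (dl (s x))) * poly p (size x + poly q (size x))"
      using q[of x] by (intro *) (meson in_set_takeD less_imp_le_nat order_trans size_mem_dl)
    also have "\<dots> \<le> poly r (size x) + poly q (size x) * poly p (size x + poly q (size x))"
      using r[of x] q[of x] length_dl_le[of "s x"] by (intro add_mono mult_right_mono) auto
    finally show "size (fold (H x) (take i (dl (s x))) (g x)) \<le> poly (r + q * pcompose p ([:0,1:] + q)) (size x)"
      by (simp add: poly_pcompose)
  qed
qed

section \<open>Polynomial-time predicates and closure rules\<close>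

named_theorems poly_time_intros

lemmas [poly_time_intros] = poly_time_id poly_time_const poly_time_Bin poly_time_hd poly_time_tl

definition poly_time_pred :: "(dtree \<Rightarrow> bool) \<Rightarrow> bool" where
  "poly_time_pred P \<longleftrightarrow> poly_time (\<lambda>x. if P x then Bin Tip Tip else Tip)"

lemma poly_time_if [poly_time_intros]:
  assumes "poly_time_pred P" "poly_time f" "poly_time g"
  shows "poly_time (\<lambda>x. if P x then f x else g x)"
proof -
  have "poly_time (\<lambda>x. if (if P x then Bin Tip Tip else Tip) = Tip then g x else f x)"
    using assms by (intro poly_time_if_Tip) (auto simp: poly_time_pred_def)
  moreover have "(\<lambda>x. if (if P x then Bin Tip Tip else Tip) = Tip then g x else f x) =
     (\<lambda>x. if P x then f x else g x)" by auto
  ultimately show ?thesis by simp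
qed

lemma poly_time_pred_eq_Tip [poly_time_intros]: "poly_time f \<Longrightarrow> poly_time_pred (\<lambda>x. f x = Tip)"
  unfolding poly_time_pred_def by (intro poly_time_if_Tip poly_time_intros)

lemma if_not: "(if \<not> b then u else v) = (if b then v else u)"
  by simp

lemma poly_time_pred_not [poly_time_intros]: "poly_time_pred P \<Longrightarrow> poly_time_pred (\<lambda>x. \<not> P x)"
  using poly_time_if[of P "\<lambda>_. Tip" "\<lambda>_. Bin Tip Tip"]
  by (simp add: poly_time_pred_def[of "\<lambda>x. \<not> P x"] poly_time_const if_not)

lemma poly_time_pred_conj [poly_time_intros]:
  assumes "poly_time_pred P" "poly_time_pred Q" shows "poly_time_pred (\<lambda>x. P x \<and> Q x)"
proof -
  have "poly_time (\<lambda>x. if P x then (if Q x then Bin Tip Tip else Tip) else Tip)"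
    using assms by (intro poly_time_intros)
  moreover have "(\<lambda>x. if P x then (if Q x then Bin Tip Tip else Tip) else Tip) = (\<lambda>x. if P x \<and> Q x then Bin Tip Tip else Tip)"
    by auto
  ultimately show ?thesis unfolding poly_time_pred_def by simp
qed

lemma poly_time_pred_disj [poly_time_intros]:
  assumes "poly_time_pred P" "poly_time_pred Q" shows "poly_time_pred (\<lambda>x. P x \<or> Q x)"
  using poly_time_pred_not[OF poly_time_pred_conj[OF poly_time_pred_not[OF assms(1)] poly_time_pred_not[OF assms(2)]]]
  by simp

lemma poly_time_pred_comp: "poly_time_pred P \<Longrightarrow> poly_time f \<Longrightarrow> poly_time_pred (\<lambda>x. P (f x))"
  unfolding poly_time_pred_def by (rule poly_time_comp)

lemma poly_time_pred_ex:
  assumes "poly_time s" and P: "poly_time_pred (\<lambda>y. P (hd_tree y) (tl_tree y))"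
  shows "poly_time_pred (\<lambda>x. \<exists>a\<in>set (dl (s x)). P x a)"
proof -
  have "poly_time_pred (\<lambda>y. P (hd_tree y) (hd_tree (tl_tree y)))"
    using poly_time_pred_comp[OF P, of "\<lambda>y. Bin (hd_tree y) (hd_tree (tl_tree y))"]
    by (simp add: poly_time_intros)
  then have "poly_time (\<lambda>x. fold (\<lambda>a acc. if P x a then Bin Tip Tip else acc) (dl (s x)) Tip)"
    by (intro poly_time_fold_additive[where p = "[:1:]" and H = "\<lambda>x a acc. if P x a then Bin Tip Tip else acc"]
       assms poly_time_intros) auto
  moreover have "fold (\<lambda>a acc. if P x a then Bin Tip Tip else acc) as acc = 
    (if \<exists>a\<in>set as. P x a then Bin Tip Tip else acc)" for x as acc
    by (induction as arbitrary: acc) auto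
  ultimately show ?thesis by (simp add: poly_time_pred_def)
qed

lemma poly_time_pred_all:
  assumes "poly_time s" "poly_time_pred (\<lambda>y. P (hd_tree y) (tl_tree y))"
  shows "poly_time_pred (\<lambda>x. \<forall>a\<in>set (dl (s x)). P x a)"
  using poly_time_pred_not[OF poly_time_pred_ex[OF assms(1) poly_time_pred_not[OF assms(2)]]] by simp

section \<open>List operations and unary arithmetic\<close>

definition rev_tree :: "dtree \<Rightarrow> dtree" where
  "rev_tree t = enc_list (rev (dl t))"

definition append_tree :: "dtree \<Rightarrow> dtree \<Rightarrow> dtree" where
  "append_tree s t = enc_list (dl s @ dl t)"

text \<open>The first argument counts only by its length: it serves as a unary number.\<close>

definition drop_tree :: "dtree \<Rightarrow> dtree \<Rightarrow> dtree" where
  "drop_tree s t = enc_list (drop (length (dl s)) (dl t))"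

definition take_tree :: "dtree \<Rightarrow> dtree \<Rightarrow> dtree" where
  "take_tree s t = enc_list (take (length (dl s)) (dl t))"

definition mult_tree :: "dtree \<Rightarrow> dtree \<Rightarrow> dtree" where
  "mult_tree s t = enc_nat (length (dl s) * length (dl t))"

definition range_tree :: "dtree \<Rightarrow> dtree" where
  "range_tree t = enc_list (map enc_nat [0..<length (dl t)])"

lemma dl_rev_tree [simp]: "dl (rev_tree t) = rev (dl t)"
  and dl_append_tree [simp]: "dl (append_tree s t) = dl s @ dl t"
  and dl_drop_tree [simp]: "dl (drop_tree s t) = drop (length (dl s)) (dl t)"
  and dl_take_tree [simp]: "dl (take_tree s t) = take (length (dl s)) (dl t)"
  and dl_range_tree [simp]: "dl (range_tree t) = map enc_nat [0..<length (dl t)]"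
  and dl_mult_tree [simp]: "dl (mult_tree s t) = replicate (length (dl s) * length (dl t)) Tip"
  by (simp_all add: rev_tree_def append_tree_def drop_tree_def take_tree_def range_tree_def mult_tree_def)

lemma size_append_tree: "size (append_tree s t) = size s + size t"
  by (simp add: size_eq_dl)

lemma append_enc_nat: "append_tree (enc_nat m) (enc_nat n) = enc_nat (m + n)"
  by (simp add: append_tree_def enc_nat_def flip: replicate_add)

lemma fold_Bin: "fold Bin as t = enc_list (rev as @ dl t)"
  by (induction as arbitrary: t) auto

lemma fold_tl_tree: "fold (\<lambda>_. tl_tree) as t = enc_list (drop (length as) (dl t))"
proof (induction as arbitrary: t)
  case (Cons a as)
  then show ?case by (cases t) auto
qed simp

lemma poly_time_rev_tree [poly_time_intros]:
  assumes "poly_time f" shows "poly_time (\<lambda>x. rev_tree (f x))"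
proof -
  have "poly_time (\<lambda>x. fold Bin (dl (f x)) Tip)"
    by (intro poly_time_fold_additive[where p = "[:1,1:]" and H = "\<lambda>x. Bin"] assms poly_time_intros) auto
  then show ?thesis by (simp add: fold_Bin rev_tree_def)
qed

lemma poly_time_append_tree [poly_time_intros]:
  assumes "poly_time f" "poly_time g" shows "poly_time (\<lambda>x. append_tree (f x) (g x))"
proof -
  have "poly_time (\<lambda>x. fold Bin (dl (rev_tree (f x))) (g x))"
    by (intro poly_time_fold_additive[where p = "[:1,1:]" and H = "\<lambda>x. Bin"] assms poly_time_intros) auto
  then show ?thesis by (simp add: fold_Bin append_tree_def)
qed

lemma poly_time_drop_tree [poly_time_intros]:
  assumes "poly_time f" "poly_time g" shows "poly_time (\<lambda>x. drop_tree (f x) (g x))"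
proof -
  have "poly_time (\<lambda>x. fold (\<lambda>_. tl_tree) (dl (f x)) (g x))"
    by (intro poly_time_fold_additive[where p = "0" and H = "\<lambda>x _. tl_tree"] assms poly_time_intros)
       (auto simp: size_tl_tree)
  then show ?thesis by (simp add: fold_tl_tree drop_tree_def)
qed

lemma poly_time_take_tree [poly_time_intros]:
  assumes "poly_time f" "poly_time g" shows "poly_time (\<lambda>x. take_tree (f x) (g x))"
proof -
  \<comment> \<open>\<open>drop_tree s t\<close> doubles as the unary number of elements to be cut
    off at the end.\<close>
  have "take_tree s t = rev_tree (drop_tree (drop_tree s t) (rev_tree t))" for s t
    by (simp flip: dl_inject add: rev_drop) (metis diff_diff_cancel nat_le_linear diff_is_0_eq diff_zero take_all)
  then show ?thesis using assms by (auto intro!: poly_time_intros)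
qed

lemma poly_time_unary [poly_time_intros]:
  assumes "poly_time f" shows "poly_time (\<lambda>x. enc_nat (length (dl (f x))))"
proof -
  have "poly_time (\<lambda>x. fold (\<lambda>_. Bin Tip) (dl (f x)) Tip)"
    by (intro poly_time_fold_additive[where p = "1" and H = "\<lambda>x _. Bin Tip"] assms poly_time_intros) auto
  moreover have "fold (\<lambda>_. Bin Tip) as (enc_nat n) = enc_nat (n + length as)" for as :: "dtree list" and n
    by (induction as arbitrary: n) (auto simp flip: enc_nat_Suc)
  from this[of _ 0] have "fold (\<lambda>_. Bin Tip) as Tip = enc_nat (length as)" for as :: "dtree list" by simp
  ultimately show ?thesis by simp
qed

lemma poly_time_mult_tree [poly_time_intros]:
  assumes "poly_time f" "poly_time g" shows "poly_time (\<lambda>x. mult_tree (f x) (g x))"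
proof -
  let ?h = "\<lambda>y. fold (\<lambda>_ acc. append_tree (enc_nat (length (dl (tl_tree y)))) acc) (dl (hd_tree y)) Tip"
  have "poly_time ?h"
    by (intro poly_time_fold_additive[where p = "[:0,1:]" 
         and H = "\<lambda>y _ acc. append_tree (enc_nat (length (dl (tl_tree y)))) acc"] assms poly_time_intros)
       (auto simp: size_append_tree simp del: dl_tl_tree intro: order_trans[OF length_dl_le] trans_le_add1 size_tl_tree)
  then have "poly_time (\<lambda>x. ?h (Bin (f x) (g x)))"
    by (rule poly_time_comp) (intro assms poly_time_intros)
  moreover have "fold (\<lambda>_ acc. append_tree (enc_nat k) acc) as (enc_nat n) = enc_nat (n + length as * k)" 
    for as :: "dtree list" and n k
    by (induction as arbitrary: n) (auto simp: append_enc_nat algebra_simps)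
  from this[of _ _ 0] have "fold (\<lambda>_ acc. append_tree (enc_nat k) acc) as Tip = enc_nat (length as * k)" 
    for as :: "dtree list" and k by simp
  ultimately show ?thesis by (simp add: mult_tree_def)
qed

lemma poly_time_range_tree [poly_time_intros]:
  assumes "poly_time f" shows "poly_time (\<lambda>x. range_tree (f x))"
proof -
  \<comment> \<open>Numbers are put in front from the top down. The next one is
    \<open>length (dl x) - Suc (length (dl acc))\<close>, obtained in unary by dropping from
    \<open>x\<close> one element more than the accumulator has.\<close>
  let ?H = "\<lambda>x (_::dtree) acc. Bin (enc_nat (length (dl (drop_tree (Bin Tip acc) x)))) acc"
  have "poly_time (\<lambda>x. fold (?H x) (dl x) Tip)"
  proof (intro poly_time_fold_additive[where p = "[:1,1:]" and H = ?H] assms poly_time_intros)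
    fix x a acc
    show "size (?H x a acc) \<le> size acc + poly [:1, 1:] (size x + size a)"
      using length_dl_le[of x] by simp
  qed
  then have "poly_time (\<lambda>x. fold (?H (f x)) (dl (f x)) Tip)"
    using assms by (rule poly_time_comp)
  moreover have "fold (?H t) as (enc_list (map enc_nat [i..<length (dl t)])) = 
      enc_list (map enc_nat [i - length as..<length (dl t)])" if "length as \<le> i" "i \<le> length (dl t)" for t i as
    using that
  proof (induction as arbitrary: i)
    case (Cons a as)
    have "[i - 1..<length (dl t)] = (i - 1) # [i..<length (dl t)]"
      using Cons.prems by (simp add: upt_conv_Cons)
    then have e: "?H t a (enc_list (map enc_nat [i..<length (dl t)])) = enc_list (map enc_nat [i - 1..<length (dl t)])"
      using Cons.prems by (simp add: diff_diff_eq)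
    show ?case using Cons.prems Cons.IH[of "i - 1"] by (simp add: e del: dl_drop_tree)
  qed simp
  from this[of "dl t" "length (dl t)" t for t] 
  have "fold (?H t) (dl t) Tip = range_tree t" for t by (simp add: range_tree_def)
  ultimately show ?thesis by simp
qed

lemma poly_time_filter:
  assumes "poly_time s" and P: "poly_time_pred (\<lambda>y. P (hd_tree y) (tl_tree y))"
  shows "poly_time (\<lambda>x. enc_list (filter (P x) (dl (s x))))"
proof -
  have "poly_time_pred (\<lambda>y. P (hd_tree y) (hd_tree (tl_tree y)))"
    using poly_time_pred_comp[OF P, of "\<lambda>y. Bin (hd_tree y) (hd_tree (tl_tree y))"]
    by (simp add: poly_time_intros)
  then have "poly_time (\<lambda>x. fold (\<lambda>a acc. if P x a then Bin a acc else acc) (dl (rev_tree (s x))) Tip)"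
    by (intro poly_time_fold_additive[where p = "[:1,1:]" and H = "\<lambda>x a acc. if P x a then Bin a acc else acc"]
       assms poly_time_intros) auto
  moreover have "fold (\<lambda>a acc. if P x a then Bin a acc else acc) as acc = 
    enc_list (rev (filter (P x) as) @ dl acc)" for x as acc
    by (induction as arbitrary: acc) auto
  ultimately show ?thesis by (simp add: rev_filter)
qed

lemma poly_time_pred_length_less [poly_time_intros]:
  assumes "poly_time f" "poly_time g"
  shows "poly_time_pred (\<lambda>x. length (dl (f x)) < length (dl (g x)))"
proof -
  have "poly_time_pred (\<lambda>x. \<not> drop_tree (f x) (g x) = Tip)"
    by (intro assms poly_time_intros)
  then show ?thesis by (simp flip: dl_eq_Nil add: not_le)
qed

lemma poly_time_pred_length_le [poly_time_intros]:
  assumes "poly_time f" "poly_time g"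
  shows "poly_time_pred (\<lambda>x. length (dl (f x)) \<le> length (dl (g x)))"
  using poly_time_pred_not[OF poly_time_pred_length_less[OF assms(2,1)]] by (simp add: not_less)

lemma poly_time_power [poly_time_intros]:
  assumes "poly_time f" shows "poly_time (\<lambda>x. enc_nat (length (dl (f x)) ^ c))"
proof (induction c)
  case (Suc c)
  have "poly_time (\<lambda>x. mult_tree (f x) (enc_nat (length (dl (f x)) ^ c)))"
    by (intro assms poly_time_intros Suc)
  then show ?case by (simp add: mult_tree_def)
qed (simp add: poly_time_const)

text \<open>Supplies of coins are polynomials in the number of nodes, not in the length of a list.
  The nodes are counted by a traversal with an explicit stack of pending subtrees.\<close>

lemma poly_time_size_unary: "poly_time (\<lambda>x. enc_nat (size x))"
proof -
  define total where "total t = sum_list (map size (dl t))" for t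
  let ?step = "\<lambda>y. if hd_tree (hd_tree y) = Tip then Bin (tl_tree (hd_tree y)) (tl_tree y)
     else Bin (Bin (hd_tree (hd_tree (hd_tree y))) (Bin (tl_tree (hd_tree (hd_tree y))) (tl_tree (hd_tree y))))
            (Bin Tip (tl_tree y))"
  have "poly_time (\<lambda>x. Bin Tip (enc_nat (size x)))"
  \<comment> \<open>Expanding a node lowers \<open>total\<close> by 1 and lengthens the stack by 1;
    discarding a \<open>Tip\<close> only shortens the stack. The weight 2 makes the measure decrease
    in both cases. The stack is at most one longer than the count, which bounds the size of the
    state.\<close>
  proof (rule poly_time_while[where init = "\<lambda>x. Bin (Bin x Tip) Tip" and step = ?step
      and Inv = "\<lambda>x y. \<exists>s a. y = Bin s (enc_nat a) \<and> total s + a = size x \<and> length (dl s) \<le> Suc a"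
      and \<mu> = "\<lambda>y. 2 * total (hd_tree y) + length (dl (hd_tree y))" and p = "[:3,3:]"])
    show "poly_time ?step" by (intro poly_time_intros)
    show "poly_time (\<lambda>x. Bin (Bin x Tip) Tip)" by (intro poly_time_intros)
    show "\<exists>s a. Bin (Bin x Tip) Tip = Bin s (enc_nat a) \<and> total s + a = size x \<and> length (dl s) \<le> Suc a" for x
      by (intro exI[of _ "Bin x Tip"] exI[of _ 0]) (simp add: total_def)
    show "2 * total (hd_tree (Bin (Bin x Tip) Tip)) + length (dl (hd_tree (Bin (Bin x Tip) Tip))) \<le> poly [:3,3:] (size x)" for x
      by (simp add: total_def)
    fix x y
    assume "\<exists>s a. y = Bin s (enc_nat a) \<and> total s + a = size x \<and> length (dl s) \<le> Suc a"
    then obtain s a where y: "y = Bin s (enc_nat a)" "total s + a = size x" "length (dl s) \<le> Suc a" by blast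
    show "size y \<le> poly [:3,3:] (size x)" using y by (simp add: size_eq_dl[of s] flip: total_def)
    show "y = Bin Tip (enc_nat (size x))" if "hd_tree y = Tip" using that y by (simp add: total_def)
    assume "hd_tree y \<noteq> Tip"
    then obtain t r where s: "s = Bin t r" using y(1) by (cases s) auto
    show "(\<exists>s a. ?step y = Bin s (enc_nat a) \<and> total s + a = size x \<and> length (dl s) \<le> Suc a) \<and>
       2 * total (hd_tree (?step y)) + length (dl (hd_tree (?step y))) < 2 * total (hd_tree y) + length (dl (hd_tree y))"
    proof (cases t)
      case Tip
      then show ?thesis using y unfolding s by (auto simp: total_def)
    next
      case (Bin u v)
      show ?thesis using y unfolding s Bin
        by (auto simp: total_def enc_nat_Suc intro!: exI[of _ "Suc a"])
    qed
  qed
  from poly_time_tl[OF this] show ?thesis by simp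
qed

lemma poly_time_poly_size [poly_time_intros]:
  fixes q :: "nat poly"
  assumes "poly_time f" shows "poly_time (\<lambda>x. enc_nat (poly q (size (f x))))"
proof -
  have "poly_time (\<lambda>x. enc_nat (poly q (size x)))"
  \<comment> \<open>Horner's scheme in unary arithmetic.\<close>
  proof (induction q)
    case (pCons a q)
    have "poly_time (\<lambda>x. append_tree (enc_nat a) (mult_tree (enc_nat (size x)) (enc_nat (poly q (size x)))))"
      by (intro poly_time_intros poly_time_size_unary pCons)
    then show ?case by (simp add: append_enc_nat mult_tree_def)
  qed (simp add: poly_time_const)
  from poly_time_comp[OF this assms] show ?thesis .
qed

section \<open>Randomized polynomial time\<close>

definition coins :: "nat \<Rightarrow> bool list pmf" where
  "coins n = pmf_of_set {bs. length bs = n}"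

lemma finite_lists_length: "finite {bs :: bool list. length bs = n}"
  using finite_lists_length_eq[of "UNIV :: bool set" n] by simp

lemma lists_length_nonempty: "{bs :: bool list. length bs = n} \<noteq> {}"
  by (auto intro!: exI[of _ "replicate n True"])

lemma set_coins [simp]: "set_pmf (coins n) = {bs. length bs = n}"
  unfolding coins_def by (rule set_pmf_of_set[OF lists_length_nonempty finite_lists_length])

lemma pair_pmf_of_set:
  assumes "finite A" "A \<noteq> {}" "finite B" "B \<noteq> {}"
  shows "pair_pmf (pmf_of_set A) (pmf_of_set B) = pmf_of_set (A \<times> B)"
proof (rule pmf_eqI)
  fix p
  have "A \<times> B \<noteq> {}" using assms by auto
  then show "pmf (pair_pmf (pmf_of_set A) (pmf_of_set B)) p = pmf (pmf_of_set (A \<times> B)) p"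
    using assms by (cases p) (simp add: pmf_pair pmf_of_set card_cartesian_product indicator_def)
qed

lemma coins_add: "coins (m + n) = map_pmf (\<lambda>(xs, ys). xs @ ys) (pair_pmf (coins m) (coins n))"
proof -
  let ?L = "\<lambda>n. {bs :: bool list. length bs = n}"
  have "inj_on (\<lambda>(xs, ys). xs @ ys) (?L m \<times> ?L n)" by (auto simp: inj_on_def)
  moreover have "(\<lambda>(xs, ys). xs @ ys) ` (?L m \<times> ?L n) = ?L (m + n)"
  proof safe
    fix bs :: "bool list" assume "length bs = m + n"
    then show "bs \<in> (\<lambda>(xs, ys). xs @ ys) ` (?L m \<times> ?L n)"
      by (intro image_eqI[of _ _ "(take m bs, drop m bs)"]) auto
  qed auto
  ultimately show ?thesis
    using lists_length_nonempty finite_lists_length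
    by (simp add: coins_def pair_pmf_of_set map_pmf_of_set_inj)
qed

text \<open>Splitting is a bijection between words and pairs of words, so prefix and remainder are
  independent. All independence among coins is taken from here.\<close>

lemma split_coins: "map_pmf (\<lambda>bs. (take m bs, drop m bs)) (coins (m + n)) = pair_pmf (coins m) (coins n)"
proof -
  have "map_pmf (\<lambda>bs. (take m bs, drop m bs)) (coins (m + n)) = 
     map_pmf (\<lambda>p. p) (pair_pmf (coins m) (coins n))"
    unfolding coins_add pmf.map_comp by (intro pmf.map_cong0) auto
  then show ?thesis by simp
qed

lemma take_coins: "m \<le> n \<Longrightarrow> map_pmf (take m) (coins n) = coins m"
  using arg_cong[OF split_coins[of m "n - m"], of "map_pmf fst"]
  by (simp add: pmf.map_comp map_fst_pair_pmf comp_def)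

lemma size_drop_tree: "size (drop_tree s t) \<le> size t"
proof -
  have "sum_list (map size (drop n ts)) \<le> sum_list (map size ts)" for n and ts :: "dtree list"
    by (metis append_take_drop_id le_add2 map_append sum_list_append)
  then show ?thesis by (simp add: size_eq_dl add_mono)
qed

lemma size_enc_bits: "size (enc_bits bs) \<le> 2 * length bs"
  by (induction bs) (auto simp: enc_bits_def)

lemma dl_enc_bits: "dl (enc_bits bs) = map (\<lambda>b. if b then Bin Tip Tip else Tip) bs"
  by (simp add: enc_bits_def)

lemma drop_enc_bits [simp]: "drop_tree t (enc_bits bs) = enc_bits (drop (length (dl t)) bs)"
  by (simp add: drop_tree_def dl_enc_bits enc_bits_def drop_map)

lemma take_enc_bits [simp]: "take_tree t (enc_bits bs) = enc_bits (take (length (dl t)) bs)"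
  by (simp add: take_tree_def dl_enc_bits enc_bits_def take_map)

lemma rand_poly_time_iff:
  "rand_poly_time A \<longleftrightarrow> (\<exists>f q. poly_time f \<and> (\<forall>x. A x = map_pmf (\<lambda>bs. f (Bin x (enc_bits bs))) (coins (poly q (size x)))))"
  by (simp add: rand_poly_time_def coins_def)

text \<open>One word of coins feeds both stages. The demand of the second stage depends on the
  random intermediate value, so the supply is a polynomial upper bound in \<open>size x\<close>, and
  \<open>take_coins\<close> discards the surplus.\<close>

lemma rand_poly_time_bind:
  assumes "rand_poly_time R" "rand_poly_time A" "poly_time g" "poly_time v"
  shows "rand_poly_time (\<lambda>x. bind_pmf (R x) (\<lambda>y. map_pmf (\<lambda>z. v (Bin y z)) (A (g y))))"
proof -
  obtain f q where f: "poly_time f" "\<And>x. R x = map_pmf (\<lambda>bs. f (Bin x (enc_bits bs))) (coins (poly q (size x)))"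
    using assms(1) rand_poly_time_iff by auto
  obtain h p where h: "poly_time h" "\<And>x. A x = map_pmf (\<lambda>bs. h (Bin x (enc_bits bs))) (coins (poly p (size x)))"
    using assms(2) rand_poly_time_iff by auto
  have gf: "poly_time (\<lambda>x. g (f x))" using poly_time_comp f assms by blast
  then obtain r where r: "\<And>x. size (g (f x)) \<le> poly r (size x)" using poly_time_size by blast
  \<comment> \<open>\<open>[:1,1:] + smult 2 q\<close> bounds the size of the input together with
    the coins of the first stage, since an encoded bit takes at most two nodes.\<close>
  define b where "b = pcompose p (pcompose r ([:1,1:] + smult 2 q))"
  have b: "poly p (size (g (f (Bin x (enc_bits bs))))) \<le> poly b (size x)" 
    if "length bs = poly q (size x)" for x bs
  proof -
    have "size (g (f (Bin x (enc_bits bs)))) \<le> poly r (size (Bin x (enc_bits bs)))" by (rule r)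
    also have "\<dots> \<le> poly r (1 + size x + 2 * poly q (size x))"
      using size_enc_bits[of bs] that by (intro poly_nat_mono) simp
    finally show ?thesis unfolding b_def poly_pcompose by (auto intro!: poly_nat_mono)
  qed
  let ?n = "\<lambda>w. enc_nat (poly q (size (hd_tree w)))"
  let ?y = "\<lambda>w. f (Bin (hd_tree w) (take_tree (?n w) (tl_tree w)))"
  let ?F = "\<lambda>w. v (Bin (?y w) (h (Bin (g (?y w)) 
     (take_tree (enc_nat (poly p (size (g (?y w))))) (drop_tree (?n w) (tl_tree w))))))"
  have F: "poly_time ?F"
    by (intro poly_time_comp[OF assms(4)] poly_time_comp[OF assms(3)] poly_time_comp[OF f(1)] 
       poly_time_comp[OF h(1)] poly_time_intros)
  have "bind_pmf (R x) (\<lambda>y. map_pmf (\<lambda>z. v (Bin y z)) (A (g y))) =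
      map_pmf (\<lambda>bs. ?F (Bin x (enc_bits bs))) (coins (poly (q + b) (size x)))" for x
  proof -
    let ?q = "poly q (size x)" and ?b = "poly b (size x)"
    let ?y = "\<lambda>bs. f (Bin x (enc_bits bs))"
    have "map_pmf (\<lambda>bs. ?F (Bin x (enc_bits bs))) (coins (poly (q + b) (size x))) =
       map_pmf (\<lambda>(bs, cs). v (Bin (?y bs) (h (Bin (g (?y bs)) (enc_bits (take (poly p (size (g (?y bs)))) cs))))))
         (map_pmf (\<lambda>bs. (take ?q bs, drop ?q bs)) (coins (?q + ?b)))"
      by (simp add: pmf.map_comp comp_def)
    also have "\<dots> = bind_pmf (coins ?q) (\<lambda>bs. map_pmf (\<lambda>z. v (Bin (?y bs) z))
        (map_pmf (\<lambda>cs. h (Bin (g (?y bs)) (enc_bits cs))) (map_pmf (take (poly p (size (g (?y bs))))) (coins ?b))))"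
      unfolding split_coins by (simp add: pair_pmf_def map_bind_pmf pmf.map_comp comp_def map_pmf_def bind_assoc_pmf bind_return_pmf)
    also have "\<dots> = bind_pmf (coins ?q) (\<lambda>bs. map_pmf (\<lambda>z. v (Bin (?y bs) z)) (A (g (?y bs))))"
      using b by (intro bind_pmf_cong refl) (simp add: take_coins h(2))
    also have "\<dots> = bind_pmf (R x) (\<lambda>y. map_pmf (\<lambda>z. v (Bin y z)) (A (g y)))"
      by (simp add: f(2) bind_map_pmf)
    finally show ?thesis by simp
  qed
  then show ?thesis using F rand_poly_time_iff by blast
qed

text \<open>Runs \<open>size x\<close> copies on consecutive blocks of coins and answers
  \<open>Tip\<close> only if all of them do. An answer that is certainly \<open>Tip\<close> stays
  so, and a constant probability below 1 decays as the input grows.\<close>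

lemma rand_poly_time_amplify:
  assumes "rand_poly_time A"
  obtains D where "rand_poly_time D" "\<And>x. pmf (D x) Tip = pmf (A x) Tip ^ size x"
proof -
  obtain f q where f: "poly_time f" "\<And>x. A x = map_pmf (\<lambda>bs. f (Bin x (enc_bits bs))) (coins (poly q (size x)))"
    using assms(1) rand_poly_time_iff by auto
  let ?q = "\<lambda>w. enc_nat (poly q (size (hd_tree w)))"
  \<comment> \<open>The accumulator holds the coins still to be read and the verdict. A verdict
    other than \<open>Tip\<close> never reverts to \<open>Tip\<close>.\<close>
  define H where "H w (u :: dtree) acc = Bin (drop_tree (?q w) (hd_tree acc))
     (if f (Bin (hd_tree w) (take_tree (?q w) (hd_tree acc))) = Tip then tl_tree acc else Bin Tip Tip)" for w u acc
  define F where "F w = tl_tree (fold (H w) (dl (enc_nat (poly [:0,1:] (size (hd_tree w))))) (Bin (tl_tree w) Tip))" for w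
  have F: "poly_time F"
    unfolding F_def
  proof (intro poly_time_fold_additive[where H = H and p = "[:2:]"] poly_time_intros)
    show "poly_time (\<lambda>y. H (hd_tree y) (hd_tree (tl_tree y)) (tl_tree (tl_tree y)))"
      unfolding H_def by (intro poly_time_intros poly_time_comp[OF f(1)])
    show "size (H w a acc) \<le> size acc + poly [:2:] (size w + size a)" for w a acc
      using size_drop_tree[of "?q w" "hd_tree acc"] by (cases acc) (auto simp: H_def)
  qed
  \<comment> \<open>The event that the first blocks, as many as the recursion argument says, all
    yield \<open>Tip\<close>.\<close>
  define ok where "ok x = rec_nat (\<lambda>bs. True) 
     (\<lambda>_ P bs. f (Bin x (enc_bits (take (poly q (size x)) bs))) = Tip \<and> P (drop (poly q (size x)) bs))" for x
  have ok_0: "ok x 0 bs" for x bs by (simp add: ok_def)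
  have ok_Suc: "ok x (Suc n) bs \<longleftrightarrow> f (Bin x (enc_bits (take (poly q (size x)) bs))) = Tip \<and> 
     ok x n (drop (poly q (size x)) bs)" for x n bs by (simp add: ok_def)
  have run: "tl_tree (fold (H (Bin x b)) (replicate n Tip) (Bin (enc_bits bs) r)) = Tip \<longleftrightarrow> r = Tip \<and> ok x n bs" 
    for x b n bs r
    by (induction n arbitrary: bs r) (auto simp: ok_0 ok_Suc H_def)
  have prob: "measure_pmf.prob (coins (n * poly q (size x))) {bs. ok x n bs} = pmf (A x) Tip ^ n" for x n
  proof (induction n)
    case (Suc n)
    let ?m = "poly q (size x)"
    have "measure_pmf.prob (coins (Suc n * ?m)) {bs. ok x (Suc n) bs} =
       measure_pmf.prob (map_pmf (\<lambda>bs. (take ?m bs, drop ?m bs)) (coins (?m + n * ?m)))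
         ({bs. f (Bin x (enc_bits bs)) = Tip} \<times> {bs. ok x n bs})"
      by (simp add: ok_Suc vimage_def)
    also have "\<dots> = measure_pmf.prob (coins ?m) {bs. f (Bin x (enc_bits bs)) = Tip} *
       measure_pmf.prob (coins (n * ?m)) {bs. ok x n bs}"
      unfolding split_coins by (intro measure_pmf_prob_product) auto
    also have "measure_pmf.prob (coins ?m) {bs. f (Bin x (enc_bits bs)) = Tip} = pmf (A x) Tip"
      by (simp add: f(2) pmf_map vimage_def)
    finally show ?case using Suc by simp
  qed (simp add: ok_0)
  define D where "D x = map_pmf (\<lambda>bs. F (Bin x (enc_bits bs))) (coins (poly ([:0,1:] * q) (size x)))" for x
  have "pmf (D x) Tip = measure_pmf.prob (coins (size x * poly q (size x))) {bs. ok x (size x) bs}" for x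
    using run[of x _ "size x" _ Tip] by (simp add: D_def pmf_map vimage_def F_def)
  moreover have "rand_poly_time D" using F rand_poly_time_iff D_def by blast
  ultimately show ?thesis using prob that by simp
qed

section \<open>Random labels\<close>

text \<open>The number of coins per label. Since the number of labels is a power of 2, fair coins
  make a label exactly uniform.\<close>

definition lg :: "nat \<Rightarrow> nat" where
  "lg n = (LEAST i. n \<le> 2 ^ i)"

lemma le_two_power_lg: "n \<le> 2 ^ lg n"
  unfolding lg_def by (rule LeastI[of _ n]) (simp add: less_imp_le)

lemma two_power_less_iff_lg: "2 ^ i < n \<longleftrightarrow> i < lg n"
proof
  assume "2 ^ i < n"
  then have "2 ^ i < (2::nat) ^ lg n" using le_two_power_lg[of n] by linarith
  then show "i < lg n" by simp
next
  assume "i < lg n"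
  then show "2 ^ i < n" unfolding lg_def using not_less_Least by force
qed

lemma lg_le: "lg n \<le> n"
  using two_power_less_iff_lg[of n n] less_exp[of n] by linarith

lemma two_power_lg_le: "0 < n \<Longrightarrow> 2 ^ lg n \<le> 2 * n"
proof (cases "lg n")
  case (Suc i)
  then have "2 ^ i < n" using two_power_less_iff_lg[of i n] by simp
  then show ?thesis using Suc by simp
qed simp

text \<open>The summand 1 covers \<open>n = 0\<close>, where the power is 1.\<close>

lemma two_power_le_of_le_lg: "i \<le> lg n \<Longrightarrow> 2 ^ i \<le> 2 * n + 1"
proof -
  assume "i \<le> lg n"
  then have "2 ^ i \<le> (2::nat) ^ lg n" by (intro power_increasing) auto
  moreover have "2 ^ lg n \<le> 2 * n + 1"
  proof (cases "n = 0")
    case True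
    then have "lg n = 0" using lg_le[of n] by simp
    then show ?thesis by simp
  next
    case False
    then show ?thesis using two_power_lg_le[of n] by simp
  qed
  ultimately show ?thesis by linarith
qed

text \<open>Doubles a unary number while it is below \<open>length (dl x)\<close> and counts the
  doublings; by \<open>lg_le\<close> there are enough rounds. Doubling is not additive growth, so
  the general fold rule is applied; the test keeps the number linear in the input.\<close>

lemma poly_time_two_power_lg_pair:
  "poly_time (\<lambda>x. Bin (enc_nat (2 ^ lg (length (dl x)))) (enc_nat (lg (length (dl x)))))"
proof -
  define H where "H x (u :: dtree) acc = (if length (dl (hd_tree acc)) < length (dl x)
      then Bin (append_tree (hd_tree acc) (hd_tree acc)) (Bin Tip (tl_tree acc)) else acc)" for x u acc
  have H: "fold (H x) as (Bin (enc_nat (2 ^ i)) (enc_nat i)) =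
      Bin (enc_nat (2 ^ min (i + length as) (lg (length (dl x))))) (enc_nat (min (i + length as) (lg (length (dl x)))))"
    if "i \<le> lg (length (dl x))" for x as i
    using that
  proof (induction as arbitrary: i)
    case (Cons a as)
    show ?case
    proof (cases "i < lg (length (dl x))")
      case True
      then have "H x a (Bin (enc_nat (2 ^ i)) (enc_nat i)) = Bin (enc_nat (2 ^ Suc i)) (enc_nat (Suc i))"
        using two_power_less_iff_lg[of i "length (dl x)"]
        by (simp add: H_def append_enc_nat enc_nat_Suc mult_2)
      then show ?thesis using Cons.IH[of "Suc i"] True by simp
    next
      case False
      then have "H x a (Bin (enc_nat (2 ^ i)) (enc_nat i)) = Bin (enc_nat (2 ^ i)) (enc_nat i)"
        using two_power_less_iff_lg[of i "length (dl x)"] by (simp add: H_def)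
      then show ?thesis using Cons False by (simp add: min_absorb2)
    qed
  qed simp
  from this[of 0] have H0: "fold (H x) as (Bin (Bin Tip Tip) Tip) =
      Bin (enc_nat (2 ^ min (length as) (lg (length (dl x))))) (enc_nat (min (length as) (lg (length (dl x)))))" for x as
    by (simp add: enc_nat_Suc)
  have "poly_time (\<lambda>x. fold (H x) (dl x) (Bin (Bin Tip Tip) Tip))"
  proof (rule poly_time_fold[where p = "[:2,3:]"])
    show "poly_time (\<lambda>y. H (hd_tree y) (hd_tree (tl_tree y)) (tl_tree (tl_tree y)))"
      unfolding H_def by (intro poly_time_intros)
    fix x i
    assume "i \<le> length (dl x)"
    show "size (fold (H x) (take i (dl x)) (Bin (Bin Tip Tip) Tip)) \<le> poly [:2, 3:] (size x)"
    proof -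
      define j where "j = min (length (take i (dl x))) (lg (length (dl x)))"
      have "2 ^ j \<le> 2 * length (dl x) + 1" "j \<le> length (dl x)"
        using two_power_le_of_le_lg[of j "length (dl x)"] by (auto simp: j_def)
      then show ?thesis unfolding H0 j_def[symmetric] using length_dl_le[of x] by simp
    qed
  qed (intro poly_time_intros)+
  then show ?thesis unfolding H0 by (simp add: min_absorb2 lg_le)
qed

lemma poly_time_two_power_lg [poly_time_intros]:
  "poly_time f \<Longrightarrow> poly_time (\<lambda>x. enc_nat (2 ^ lg (length (dl (f x)))))"
  using poly_time_hd[OF poly_time_comp[OF poly_time_two_power_lg_pair]] by simp

lemma poly_time_lg [poly_time_intros]:
  "poly_time f \<Longrightarrow> poly_time (\<lambda>x. enc_nat (lg (length (dl (f x)))))"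
  using poly_time_tl[OF poly_time_comp[OF poly_time_two_power_lg_pair]] by simp

definition bits_nat :: "bool list \<Rightarrow> nat" where
  "bits_nat bs = foldl (\<lambda>c b. 2 * c + of_bool b) 0 bs"

text \<open>Reads coins from the front of a stream: the head of the result is the rest of the
  stream, the tail the number read, in unary.\<close>

primrec draw :: "nat \<Rightarrow> dtree \<Rightarrow> dtree" where
  "draw 0 b = Bin b Tip"
| "draw (Suc l) b = (let r = draw l b; d = append_tree (tl_tree r) (tl_tree r) in
     Bin (tl_tree (hd_tree r)) (if hd_tree (hd_tree r) = Tip then d else Bin Tip d))"

text \<open>Holds for arbitrary trees, because an exhausted stream reads as zeros. The running time
  has to be bounded on malformed inputs as well.\<close>

lemma draw_bound: "\<exists>c. tl_tree (draw l b) = enc_nat c \<and> c < 2 ^ l" "size (hd_tree (draw l b)) \<le> size b"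
proof (induction l)
  case (Suc l)
  {
    case 1
    from Suc(1) obtain c where "tl_tree (draw l b) = enc_nat c" "c < 2 ^ l" by blast
    then show ?case
      by (auto simp: Let_def append_enc_nat simp flip: enc_nat_Suc 
          intro: exI[of _ "c + c"] exI[of _ "Suc (c + c)"])
  next
    case 2
    then show ?case using Suc(2) size_tl_tree[of "hd_tree (draw l b)"] by (simp add: Let_def)
  }
qed auto

lemma draw_enc_bits:
  "l \<le> length bs \<Longrightarrow> draw l (enc_bits bs) = Bin (enc_bits (drop l bs)) (enc_nat (bits_nat (take l bs)))"
proof (induction l)
  case (Suc l)
  then have "drop l bs = bs ! l # drop (Suc l) bs" "take (Suc l) bs = take l bs @ [bs ! l]"
    by (auto simp: Cons_nth_drop_Suc take_Suc_conv_app_nth)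
  then show ?case using Suc
    by (auto simp: enc_bits_def append_enc_nat bits_nat_def Let_def mult_2 enc_nat_Suc)
qed (simp add: bits_nat_def)

text \<open>A unary number read from l coins can have size close to \<open>2 ^ l\<close>, so
  polynomial time rests on l being logarithmic in a unary argument.\<close>

lemma poly_time_draw:
  assumes "poly_time f" "poly_time g" shows "poly_time (\<lambda>x. draw (lg (length (dl (f x)))) (g x))"
proof -
  define H where "H (x :: dtree) (u :: dtree) r = Bin (tl_tree (hd_tree r)) (if hd_tree (hd_tree r) = Tip 
     then append_tree (tl_tree r) (tl_tree r) else Bin Tip (append_tree (tl_tree r) (tl_tree r)))" for x u r
  have H: "fold (H x) as (Bin b Tip) = draw (length as) b" for x as b
    by (induction as rule: rev_induct) (auto simp: H_def Let_def)
  let ?l = "\<lambda>x. lg (length (dl (hd_tree x)))"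
  have "poly_time (\<lambda>x. fold (H x) (dl (enc_nat (?l x))) (Bin (tl_tree x) Tip))"
  proof (rule poly_time_fold[where p = "[:2,3:]"])
    show "poly_time (\<lambda>y. H (hd_tree y) (hd_tree (tl_tree y)) (tl_tree (tl_tree y)))"
      unfolding H_def by (intro poly_time_intros)
    show "size (fold (H x) (take i (dl (enc_nat (?l x)))) (Bin (tl_tree x) Tip)) \<le> poly [:2, 3:] (size x)"
      if "i \<le> length (dl (enc_nat (?l x)))" for x i
    proof -
      have "size t \<le> 1 + size (hd_tree t) + size (tl_tree t)" for t by (cases t) auto
      from this[of "draw i (tl_tree x)"] draw_bound[of i "tl_tree x"]
        two_power_le_of_le_lg[of i "length (dl (hd_tree x))"] that
      have "size (draw i (tl_tree x)) \<le> 1 + size (tl_tree x) + (2 * length (dl (hd_tree x)) + 1)" by auto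
      moreover have "size (draw i (tl_tree x)) \<le> poly [:2, 3:] (size x)" if "x = Tip"
        using calculation that by simp
      ultimately show ?thesis unfolding H using that length_dl_le[of "hd_tree x"] by (cases x) auto
    qed
  qed (intro poly_time_intros)+
  from poly_time_comp[OF this[unfolded H] poly_time_Bin[OF assms]] show ?thesis by simp
qed

section \<open>The reduction\<close>

text \<open>A label c becomes the element \<open>n + c\<close>. It exceeds every vertex, so
  appending it to the sorted vertex list of an edge already yields the sorted encoding of the new
  set.\<close>

definition family_step :: "dtree \<Rightarrow> dtree \<Rightarrow> dtree \<Rightarrow> dtree" where
  "family_step N e acc = (let r = draw (lg (length (dl N))) (hd_tree acc) in
     Bin (hd_tree r) (Bin (append_tree e (Bin (append_tree N (tl_tree r)) Tip)) (tl_tree acc)))"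

definition instance_tree :: "dtree \<Rightarrow> dtree \<Rightarrow> dtree" where
  "instance_tree x b = (let N = hd_tree x in
     enc_list [range_tree N, drop_tree N (range_tree (append_tree N (enc_nat (2 ^ lg (length (dl N)))))),
       tl_tree (fold (family_step N) (dl (hd_tree (tl_tree (tl_tree x)))) (Bin b Tip))])"

lemma poly_time_instance_tree:
  assumes "poly_time f" "poly_time g" shows "poly_time (\<lambda>x. instance_tree (f x) (g x))"
proof -
  have "poly_time (\<lambda>w. fold (family_step (hd_tree (hd_tree w))) (dl (hd_tree (tl_tree (tl_tree (hd_tree w)))))
      (Bin (tl_tree w) Tip))"
  proof (rule poly_time_fold_additive[where p = "[:5,4:]" and H = "\<lambda>w. family_step (hd_tree (hd_tree w))"])
    show "poly_time (\<lambda>y. family_step (hd_tree (hd_tree (hd_tree y))) (hd_tree (tl_tree y)) (tl_tree (tl_tree y)))"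
      unfolding family_step_def Let_def by (intro poly_time_intros poly_time_draw)
    fix w a acc
    let ?N = "hd_tree (hd_tree w)"
    obtain c where c: "tl_tree (draw (lg (length (dl ?N))) (hd_tree acc)) = enc_nat c" "c < 2 ^ lg (length (dl ?N))"
      using draw_bound(1) by blast
    have "c \<le> 2 * length (dl ?N)" 
      using c(2) two_power_le_of_le_lg[of "lg (length (dl ?N))" "length (dl ?N)"] by simp
    moreover have "size ?N \<le> size w" using size_hd_tree order_trans by blast
    moreover have "size (hd_tree acc) + size (tl_tree acc) \<le> size acc" by (cases acc) auto
    ultimately show "size (family_step ?N a acc) \<le> size acc + poly [:5, 4:] (size w + size a)"
      using draw_bound(2)[of "lg (length (dl ?N))" "hd_tree acc"] length_dl_le[of ?N] c(1)
      by (simp add: family_step_def Let_def size_append_tree)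
  qed (intro poly_time_intros)+
  then have "poly_time (\<lambda>w. instance_tree (hd_tree w) (tl_tree w))"
    unfolding instance_tree_def Let_def enc_list_simps by (intro poly_time_intros)
  from poly_time_comp[OF this poly_time_Bin[OF assms]] show ?thesis by simp
qed

text \<open>The vertices are recovered from the answer by the mere occurrence of their unary codes, so
  that the verdict is meaningful for malformed answers too.\<close>

definition occurs :: "dtree \<Rightarrow> nat set" where
  "occurs z = {length (dl t) |S t. S \<in> set (dl z) \<and> t \<in> set (dl S)}"

text \<open>The thresholds are \<open>n powr (2 + 1/c)\<close> edges and \<open>n powr (1 - 1/c)\<close> vertices, with the roots cleared.\<close>

definition accepts :: "nat \<Rightarrow> dtree \<Rightarrow> dtree \<Rightarrow> bool" where
  "accepts c x z \<longleftrightarrow> (let N = hd_tree x; n = length (dl N); es = dl (hd_tree (tl_tree (tl_tree x))) in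
     n ^ (2 * c + 1) < length es ^ c \<or>
     length (filter (\<lambda>v. length (dl v) \<in> occurs z) (dl (range_tree N))) ^ c \<le> n ^ (c - 1) \<and>
     n \<le> length (filter (\<lambda>e. \<forall>v\<in>set (dl e). length (dl v) \<in> occurs z) es))"

section \<open>Polynomial time of the check and of a single trial\<close>

lemma poly_time_pred_occurs:
  assumes "poly_time f" "poly_time g" shows "poly_time_pred (\<lambda>y. length (dl (f y)) \<in> occurs (g y))"
proof -
  have "poly_time_pred (\<lambda>y. \<exists>S\<in>set (dl (g y)). \<exists>t\<in>set (dl S). 
      length (dl t) \<le> length (dl (f y)) \<and> length (dl (f y)) \<le> length (dl t))"
    by (intro poly_time_pred_ex poly_time_intros poly_time_comp[OF assms(1)] poly_time_comp[OF assms(2)])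
  moreover have "(\<lambda>y. \<exists>S\<in>set (dl (g y)). \<exists>t\<in>set (dl S). 
      length (dl t) \<le> length (dl (f y)) \<and> length (dl (f y)) \<le> length (dl t)) =
      (\<lambda>y. length (dl (f y)) \<in> occurs (g y))"
    unfolding occurs_def by (intro ext) (auto dest: antisym intro: order_refl, metis order_refl)
  ultimately show ?thesis by simp
qed

lemma poly_time_pred_accepts: 
  assumes "poly_time f" "poly_time g" shows "poly_time_pred (\<lambda>w. accepts c (f w) (g w))"
proof -
  have 1: "poly_time (\<lambda>w. enc_list (filter (\<lambda>v. length (dl v) \<in> occurs (tl_tree w)) (dl (range_tree (hd_tree (hd_tree w))))))"
    by (intro poly_time_filter poly_time_pred_occurs poly_time_intros)
  have 2: "poly_time (\<lambda>w. enc_list (filter (\<lambda>e. \<forall>v\<in>set (dl e). length (dl v) \<in> occurs (tl_tree w)) 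
     (dl (hd_tree (tl_tree (tl_tree (hd_tree w)))))))"
    by (intro poly_time_filter poly_time_pred_all poly_time_pred_occurs poly_time_intros)
  let ?N = "\<lambda>w. hd_tree (hd_tree w)" and ?E = "\<lambda>w. hd_tree (tl_tree (tl_tree (hd_tree w)))"
  have "poly_time_pred (\<lambda>w. length (dl (enc_nat (length (dl (?N w)) ^ (2 * c + 1)))) < length (dl (enc_nat (length (dl (?E w)) ^ c))) \<or>
     length (dl (enc_nat (length (dl (enc_list (filter (\<lambda>v. length (dl v) \<in> occurs (tl_tree w)) (dl (range_tree (?N w)))))) ^ c))) 
        \<le> length (dl (enc_nat (length (dl (?N w)) ^ (c - 1)))) \<and>
     length (dl (?N w)) \<le> length (dl (enc_list (filter (\<lambda>e. \<forall>v\<in>set (dl e). length (dl v) \<in> occurs (tl_tree w)) (dl (?E w))))))"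
    by (intro poly_time_intros 1 2)
  then have "poly_time_pred (\<lambda>w. accepts c (hd_tree w) (tl_tree w))"
    by (simp add: accepts_def Let_def del: dl_range_tree)
  from poly_time_pred_comp[OF this poly_time_Bin[OF assms]] show ?thesis by simp
qed

text \<open>The supply \<open>size x ^ 2\<close> suffices for \<open>lg n\<close> coins per edge: on
  an encoded hypergraph, both n and the number of edges are at most \<open>size x\<close>.\<close>

definition labelled_instance :: "dtree \<Rightarrow> dtree pmf" where
  "labelled_instance x = map_pmf (\<lambda>bs. instance_tree x (enc_bits bs)) (coins (size x ^ 2))"

definition trial :: "nat \<Rightarrow> (dtree \<Rightarrow> dtree pmf) \<Rightarrow> dtree \<Rightarrow> dtree pmf" where
  "trial c A x = bind_pmf (labelled_instance x) (\<lambda>y. map_pmf (\<lambda>z. if accepts c x z then Bin Tip Tip else Tip) (A y))"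

lemma rand_poly_time_trial:
  assumes "rand_poly_time A" shows "rand_poly_time (trial c A)"
proof -
  \<comment> \<open>The hypergraph travels along with the instance, as the check needs it
    again.\<close>
  let ?R = "\<lambda>x. map_pmf (\<lambda>bs. Bin x (instance_tree x (enc_bits bs))) (coins (size x ^ 2))"
  have R: "rand_poly_time ?R"
    unfolding rand_poly_time_iff
    by (intro exI[of _ "\<lambda>w. Bin (hd_tree w) (instance_tree (hd_tree w) (tl_tree w))"] exI[of _ "[:0,0,1:]"] conjI
       poly_time_intros poly_time_instance_tree) (simp add: power2_eq_square)
  have v: "poly_time (\<lambda>w. if accepts c (hd_tree (hd_tree w)) (tl_tree w) then Bin Tip Tip else Tip)"
    by (intro poly_time_intros poly_time_pred_accepts)
  have "trial c A = (\<lambda>x. bind_pmf (?R x) (\<lambda>y. map_pmf 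
     (\<lambda>z. if accepts c (hd_tree (hd_tree (Bin y z))) (tl_tree (Bin y z)) then Bin Tip Tip else Tip) (A (tl_tree y))))"
    by (intro ext) (simp add: trial_def labelled_instance_def bind_map_pmf)
  then show ?thesis using rand_poly_time_bind[OF R assms poly_time_tl[OF poly_time_id] v] by simp
qed

section \<open>Encoded hypergraphs and their labelled instances\<close>

definition edge_list :: "nat \<Rightarrow> nat set set \<Rightarrow> nat list list" where
  "edge_list n E = filter (\<lambda>vs. set vs \<in> E) (List.subseqs [0..<n])"

definition enc_edges :: "nat list list \<Rightarrow> dtree" where
  "enc_edges es = enc_list (map (\<lambda>vs. enc_list (map enc_nat vs)) es)"

lemma enc_hypergraph_eq: "enc_hypergraph n k E = enc_list [enc_nat n, enc_nat k, enc_edges (edge_list n E)]"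
  by (simp add: enc_hypergraph_def enc_edges_def edge_list_def)

lemma edge_list_sorted:
  assumes "vs \<in> set (edge_list n E)"
  shows "sorted vs" "distinct vs" "set vs \<subseteq> {..<n}" "set vs \<in> E"
proof -
  have vs: "vs \<in> set (List.subseqs [0..<n])" "set vs \<in> E" using assms by (auto simp: edge_list_def)
  then show "set vs \<subseteq> {..<n}" "set vs \<in> E"
    using subseqs_powset[of "[0..<n]"] by (auto simp: atLeast0LessThan)
  show "distinct vs" using subseqs_distinctD[OF vs(1)] by simp
  obtain A where "vs = nths [0..<n] A" using vs(1) by (auto simp: subseq_conv_nths)
  then show "sorted vs" by (simp add: sorted_nths)
qed

lemma set_edge_list: "E \<subseteq> Pow {..<n} \<Longrightarrow> set ` set (edge_list n E) = E"
proof
  assume "E \<subseteq> Pow {..<n}"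
  moreover have "set ` set (List.subseqs [0..<n]) = Pow {..<n}"
    by (simp add: subseqs_powset atLeast0LessThan)
  ultimately show "E \<subseteq> set ` set (edge_list n E)"
    unfolding edge_list_def by (smt (verit) image_iff mem_Collect_eq set_filter subset_iff)
qed (auto dest: edge_list_sorted)

lemma distinct_set_edge_list: "distinct (map set (edge_list n E))"
  unfolding edge_list_def by (intro distinct_map_filter distinct_set_subseqs) simp

lemma length_filter_edge_list:
  assumes "E \<subseteq> Pow {..<n}"
  shows "length (filter (\<lambda>vs. P (set vs)) (edge_list n E)) = card {e \<in> E. P e}"
proof -
  have "{e \<in> E. P e} = set (map set (filter (\<lambda>vs. P (set vs)) (edge_list n E)))"
    by (subst set_edge_list[OF assms, symmetric]) auto
  moreover have "distinct (map set (filter (\<lambda>vs. P (set vs)) (edge_list n E)))"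
    by (intro distinct_map_filter distinct_set_edge_list)
  ultimately show ?thesis using distinct_card by force
qed

lemma length_edge_list: "E \<subseteq> Pow {..<n} \<Longrightarrow> length (edge_list n E) = card E"
  using length_filter_edge_list[of E n "\<lambda>_. True"] by simp

lemma accepts_enc_hypergraph:
  assumes "E \<subseteq> Pow {..<n}"
  shows "accepts c (enc_hypergraph n k E) z \<longleftrightarrow> n ^ (2 * c + 1) < card E ^ c \<or>
     card ({..<n} \<inter> occurs z) ^ c \<le> n ^ (c - 1) \<and> n \<le> card {e \<in> E. e \<subseteq> occurs z}"
proof -
  have "length (filter (\<lambda>v. length (dl v) \<in> occurs z) (map enc_nat [0..<n])) = 
      length (filter (\<lambda>v. v \<in> occurs z) [0..<n])"
    by (simp add: filter_map comp_def)
  also have "\<dots> = card (set (filter (\<lambda>v. v \<in> occurs z) [0..<n]))"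
    by (intro distinct_card[symmetric]) simp
  also have "set (filter (\<lambda>v. v \<in> occurs z) [0..<n]) = {..<n} \<inter> occurs z" by auto
  finally have 1: "length (filter (\<lambda>v. length (dl v) \<in> occurs z) (map enc_nat [0..<n])) = card ({..<n} \<inter> occurs z)" .
  have "length (filter (\<lambda>e. \<forall>v\<in>set (dl e). length (dl v) \<in> occurs z) (map (\<lambda>vs. enc_list (map enc_nat vs)) (edge_list n E)))
     = length (filter (\<lambda>vs. set vs \<subseteq> occurs z) (edge_list n E))"
    by (simp add: filter_map comp_def subset_eq)
  also have "\<dots> = card {e \<in> E. e \<subseteq> occurs z}"
    by (rule length_filter_edge_list[OF assms])
  finally have 2: "length (filter (\<lambda>e. \<forall>v\<in>set (dl e). length (dl v) \<in> occurs z) 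
      (map (\<lambda>vs. enc_list (map enc_nat vs)) (edge_list n E))) = card {e \<in> E. e \<subseteq> occurs z}" .
  show ?thesis
    by (simp only: accepts_def Let_def enc_hypergraph_eq enc_edges_def enc_list_simps hd_tree.simps tl_tree.simps
       dl_range_tree dl_enc_list dl_enc_nat length_replicate 1 2 length_map length_edge_list[OF assms])
qed

fun labels :: "nat \<Rightarrow> nat \<Rightarrow> bool list \<Rightarrow> nat list" where
  "labels l 0 bs = []"
| "labels l (Suc m) bs = bits_nat (take l bs) # labels l m (drop l bs)"

lemma length_labels [simp]: "length (labels l m bs) = m"
  by (induction l m bs rule: labels.induct) auto

text \<open>The reversal matches the fold in \<open>instance_tree\<close>, which puts each new set
  in front.\<close>

definition labelled_rb :: "nat \<Rightarrow> nat list list \<Rightarrow> nat list \<Rightarrow> rb_instance" where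
  "labelled_rb n es cs = \<lparr>red = {..<n}, blue = {n..<n + 2 ^ lg n},
     fam = rev (map2 (\<lambda>vs c. insert (n + c) (set vs)) es cs)\<rparr>"

lemma enc_set_insert:
  assumes "sorted vs" "distinct vs" "set vs \<subseteq> {..<n}"
  shows "enc_set (insert (n + c) (set vs)) = enc_list (map enc_nat (vs @ [n + c]))"
proof -
  have "sorted_list_of_set (set (vs @ [n + c])) = vs @ [n + c]"
    using assms by (intro sorted_list_of_set.idem_if_sorted_distinct) (auto simp: sorted_append)
  then show ?thesis by (simp add: enc_set_def)
qed

lemma fold_family_step:
  assumes "\<And>vs. vs \<in> set es \<Longrightarrow> sorted vs \<and> distinct vs \<and> set vs \<subseteq> {..<n}" "length es * lg n \<le> length bs"
  shows "fold (family_step (enc_nat n)) (map (\<lambda>vs. enc_list (map enc_nat vs)) es) (Bin (enc_bits bs) t) =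
    Bin (enc_bits (drop (length es * lg n) bs)) (enc_list (map enc_set (rev (map2 (\<lambda>vs c. insert (n + c) (set vs)) es 
       (labels (lg n) (length es) bs))) @ dl t))"
  using assms
proof (induction es arbitrary: bs t)
  case (Cons vs es)
  have step: "family_step (enc_nat n) (enc_list (map enc_nat vs)) (Bin (enc_bits bs) t) = 
    Bin (enc_bits (drop (lg n) bs)) (Bin (enc_set (insert (n + bits_nat (take (lg n) bs)) (set vs))) t)"
    using Cons.prems 
    by (simp add: family_step_def draw_enc_bits Let_def append_enc_nat enc_set_insert append_tree_def[of "enc_list _"])
  show ?case using Cons.prems by (simp add: step Cons.IH add.commute)
qed simp

text \<open>With enough coins, the tree built from a hypergraph is a proper instance encoding, so
  the guarantee of the approximation algorithm applies to it.\<close>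

lemma instance_tree_eq:
  assumes "length (edge_list n E) * lg n \<le> length bs"
  shows "instance_tree (enc_hypergraph n k E) (enc_bits bs) =
     enc_instance (labelled_rb n (edge_list n E) (labels (lg n) (length (edge_list n E)) bs))"
proof -
  have "drop n [0..<n + 2 ^ lg n] = [n..<n + 2 ^ lg n]" by simp
  then have "drop_tree (enc_nat n) (range_tree (append_tree (enc_nat n) (enc_nat (2 ^ lg n)))) = enc_set {n..<n + 2 ^ lg n}"
    by (simp add: append_enc_nat drop_tree_def enc_set_def drop_map)
  moreover have "range_tree (enc_nat n) = enc_set {..<n}"
    by (simp add: range_tree_def enc_set_def lessThan_atLeast0)
  moreover have "fold (family_step (enc_nat n)) (dl (enc_edges (edge_list n E))) (Bin (enc_bits bs) Tip) = 
    Bin (enc_bits (drop (length (edge_list n E) * lg n) bs)) (enc_list (map enc_set (rev (map2 (\<lambda>vs c. insert (n + c) (set vs)) (edge_list n E)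
       (labels (lg n) (length (edge_list n E)) bs)))))"
    using fold_family_step[of "edge_list n E" n bs Tip] assms edge_list_sorted by (simp add: enc_edges_def)
  ultimately show ?thesis
    by (simp add: instance_tree_def Let_def enc_hypergraph_eq enc_instance_def labelled_rb_def)
qed

section \<open>The probability that all labels occur\<close>

lemma bits_nat_snoc: "bits_nat (bs @ [b]) = 2 * bits_nat bs + of_bool b"
  by (simp add: bits_nat_def)

lemma bits_nat_less: "bits_nat bs < 2 ^ length bs"
  by (induction bs rule: rev_induct) (auto simp: bits_nat_snoc, simp add: bits_nat_def)

text \<open>The last bit is the parity, so different words of equal length have different values;
  being \<open>2 ^ l\<close> many, the values fill \<open>{..<2 ^ l}\<close>.\<close>

lemma map_bits_nat_coins: "map_pmf bits_nat (coins l) = pmf_of_set {..<2 ^ l}"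
proof -
  have "bits_nat bs = bits_nat cs \<Longrightarrow> length bs = length cs \<Longrightarrow> bs = cs" for bs cs
  proof (induction bs arbitrary: cs rule: rev_induct)
    case (snoc b bs)
    then obtain ds d where cs: "cs = ds @ [d]" by (cases cs rule: rev_exhaust) auto
    have e: "2 * bits_nat bs + of_bool b = 2 * bits_nat ds + of_bool d"
      using snoc cs by (simp add: bits_nat_snoc)
    have "even (2 * bits_nat bs + of_bool b) \<longleftrightarrow> even (2 * bits_nat ds + of_bool d)"
      by (simp only: e)
    then have "b = d" by (cases b; cases d) auto
    with e snoc cs show ?case by simp
  qed simp
  then have inj: "inj_on bits_nat {bs. length bs = l}" by (auto simp: inj_on_def)
  have "card (bits_nat ` {bs. length bs = l}) = 2 ^ l"
    using card_lists_length_eq[of "UNIV :: bool set" l] by (simp add: card_image[OF inj])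
  moreover have "bits_nat ` {bs. length bs = l} \<subseteq> {..<2 ^ l}" using bits_nat_less by auto
  ultimately have "bits_nat ` {bs. length bs = l} = {..<2 ^ l}"
    by (intro card_subset_eq) auto
  then show ?thesis
    using map_pmf_of_set_inj[OF inj lists_length_nonempty finite_lists_length] by (simp add: coins_def)
qed

text \<open>The labels use disjoint blocks of coins and are independent. An edge satisfying
  \<open>P\<close> misses j with probability \<open>1 - 1 / 2 ^ l\<close>; the other edges impose no
  condition.\<close>

lemma prob_labels_miss:
  assumes "length es * l \<le> N" "j < 2 ^ l"
  shows "measure_pmf.prob (coins N) {bs. \<forall>(vs, c) \<in> set (zip es (labels l (length es) bs)). P vs \<longrightarrow> c \<noteq> j}
     = (1 - 1 / 2 ^ l) ^ length (filter P es)"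
  using assms(1)
proof (induction es arbitrary: N)
  case (Cons vs es)
  let ?X = "{bs. \<forall>(vs, c) \<in> set (zip es (labels l (length es) bs)). P vs \<longrightarrow> c \<noteq> j}"
  have N: "N = l + (N - l)" "length es * l \<le> N - l" using Cons.prems by auto
  have "measure_pmf.prob (coins N) {bs. \<forall>(vs, c) \<in> set (zip (vs # es) (labels l (length (vs # es)) bs)). P vs \<longrightarrow> c \<noteq> j} =
     measure_pmf.prob (map_pmf (\<lambda>bs. (take l bs, drop l bs)) (coins (l + (N - l))))
       ({bs. P vs \<longrightarrow> bits_nat bs \<noteq> j} \<times> ?X)"
    using N(1) by (simp add: vimage_def)
  also have "\<dots> = measure_pmf.prob (coins l) {bs. P vs \<longrightarrow> bits_nat bs \<noteq> j} * measure_pmf.prob (coins (N - l)) ?X"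
    unfolding split_coins by (intro measure_pmf_prob_product) auto
  also have "measure_pmf.prob (coins (N - l)) ?X = (1 - 1 / 2 ^ l) ^ length (filter P es)"
    by (rule Cons.IH[OF N(2)])
  also have "measure_pmf.prob (coins l) {bs. P vs \<longrightarrow> bits_nat bs \<noteq> j} = (if P vs then 1 - 1 / 2 ^ l else 1)"
  proof -
    have "measure_pmf.prob (coins l) {bs. bits_nat bs \<noteq> j} = measure_pmf.prob (map_pmf bits_nat (coins l)) (- {j})"
      by (simp add: vimage_def)
    also have "\<dots> = 1 - pmf (map_pmf bits_nat (coins l)) j"
      by (simp add: measure_pmf.prob_compl[of "{j}", simplified] Compl_eq_Diff_UNIV measure_pmf_single)
    also have "pmf (map_pmf bits_nat (coins l)) j = 1 / 2 ^ l"
      using assms(2) by (subst map_bits_nat_coins, subst pmf_of_set) (auto simp: indicator_def intro: exI[of _ 0])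
    finally show ?thesis by simp
  qed
  finally show ?case by simp
qed simp

definition complete_labels :: "nat \<Rightarrow> nat list list \<Rightarrow> (nat list \<Rightarrow> bool) \<Rightarrow> nat list \<Rightarrow> bool" where
  "complete_labels n es P cs \<longleftrightarrow> (\<forall>j < 2 ^ lg n. \<exists>vs. (vs, j) \<in> set (zip es cs) \<and> P vs)"

text \<open>Union bound over the \<open>2 ^ lg n\<close> labels.\<close>

lemma prob_not_complete_labels:
  assumes "length es * lg n \<le> N" 
  shows "measure_pmf.prob (coins N) {bs. \<not> complete_labels n es P (labels (lg n) (length es) bs)}
     \<le> 2 ^ lg n * (1 - 1 / 2 ^ lg n) ^ length (filter P es)"
proof -
  let ?X = "\<lambda>j. {bs. \<forall>(vs, c) \<in> set (zip es (labels (lg n) (length es) bs)). P vs \<longrightarrow> c \<noteq> j}"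
  have "measure_pmf.prob (coins N) {bs. \<not> complete_labels n es P (labels (lg n) (length es) bs)} \<le>
     measure_pmf.prob (coins N) (\<Union>j \<in> {..<2 ^ lg n}. ?X j)"
    by (intro measure_pmf.finite_measure_mono) (auto simp: complete_labels_def)
  also have "\<dots> \<le> (\<Sum>j<2 ^ lg n. measure_pmf.prob (coins N) (?X j))"
    by (intro measure_pmf.finite_measure_subadditive_finite) auto
  also have "\<dots> = (\<Sum>j<(2::nat) ^ lg n. (1 - 1 / 2 ^ lg n) ^ length (filter P es))"
    using prob_labels_miss[OF assms] by (intro sum.cong) auto
  finally show ?thesis by simp
qed

section \<open>Covers of labelled instances\<close>

lemma labelled_rb_simps [simp]:
  "red (labelled_rb n es cs) = {..<n}" "blue (labelled_rb n es cs) = {n..<n + 2 ^ lg n}"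
  "set (fam (labelled_rb n es cs)) = {insert (n + c) (set vs) |vs c. (vs, c) \<in> set (zip es cs)}"
  "length (fam (labelled_rb n es cs)) = min (length es) (length cs)"
  by (auto simp: labelled_rb_def)

lemma set_labels_less: "length es * l \<le> length bs \<Longrightarrow> c \<in> set (labels l (length es) bs) \<Longrightarrow> c < 2 ^ l"
proof (induction es arbitrary: bs)
  case (Cons vs es)
  then have "bits_nat (take l bs) < 2 ^ l" using bits_nat_less[of "take l bs"] by (simp add: min_absorb2)
  then show ?case using Cons.prems Cons.IH[of "drop l bs"] by auto
qed simp

text \<open>Cutting a set down to \<open>{..<n}\<close> gives back its edge. Distinct edges
  therefore give distinct sets, even when they share a label.\<close>

lemma rb_wf_labelled_rb:
  assumes "set cs \<subseteq> {..<2 ^ lg n}" "length cs = length (edge_list n E)"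
  shows "rb_wf (labelled_rb n (edge_list n E) cs)"
proof -
  let ?es = "edge_list n E"
  have sub: "set vs \<subseteq> {..<n}" if "(vs, c) \<in> set (zip ?es cs)" for vs c
    using edge_list_sorted(3) that set_zip_leftD by fastforce
  have r: "insert (n + c) (set vs) \<inter> {..<n} = set vs" if "(vs, c) \<in> set (zip ?es cs)" for vs c
    using sub[OF that] by auto
  have "map (\<lambda>S. S \<inter> {..<n}) (map2 (\<lambda>vs c. insert (n + c) (set vs)) ?es cs) = map (\<lambda>p. set (fst p)) (zip ?es cs)"
    unfolding map_map by (intro map_cong refl) (use sub in fastforce)
  also have "\<dots> = map set ?es"
    using assms(2) by (simp add: map_fst_zip flip: map_map[unfolded comp_def])
  finally have "distinct (map (\<lambda>S. S \<inter> {..<n}) (map2 (\<lambda>vs c. insert (n + c) (set vs)) ?es cs))"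
    using distinct_set_edge_list[of n E] by simp
  then have "distinct (map2 (\<lambda>vs c. insert (n + c) (set vs)) ?es cs)"
    using distinct_map by blast
  moreover have "S \<subseteq> {..<n} \<union> {n..<n + 2 ^ lg n}" if "S \<in> set (fam (labelled_rb n ?es cs))" for S
    using that assms sub by (fastforce dest: set_zip_rightD)
  ultimately show ?thesis by (auto simp: rb_wf_def labelled_rb_def)
qed

text \<open>The edges inside \<open>V\<close> carry all labels, so their sets form a cover, and its
  red elements lie in \<open>V\<close>.\<close>

lemma labelled_rb_cover:
  assumes "complete_labels n (edge_list n E) (\<lambda>vs. set vs \<subseteq> V) cs" "V \<subseteq> {..<n}"
  shows "rb_covers (labelled_rb n (edge_list n E) cs) \<noteq> {}"
    and "rb_opt (labelled_rb n (edge_list n E) cs) \<le> card V"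
proof -
  let ?I = "labelled_rb n (edge_list n E) cs"
  define F where "F = {insert (n + c) (set vs) |vs c. (vs, c) \<in> set (zip (edge_list n E) cs) \<and> set vs \<subseteq> V}"
  have "n + j \<in> \<Union>F" if j: "j < 2 ^ lg n" for j
  proof -
    obtain vs where "(vs, j) \<in> set (zip (edge_list n E) cs)" "set vs \<subseteq> V"
      using assms(1) j unfolding complete_labels_def by blast
    then have "insert (n + j) (set vs) \<in> F" unfolding F_def by blast
    then show ?thesis by blast
  qed
  then have "b \<in> \<Union>F" if "b \<in> {n..<n + 2 ^ lg n}" for b
    using that by (metis add_diff_inverse_nat atLeastLessThan_iff nat_add_left_cancel_less not_less)
  then have F: "F \<in> rb_covers ?I" by (auto simp: rb_covers_def F_def)
  then show "rb_covers ?I \<noteq> {}" by blast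
  have "finite (rb_covers ?I)" 
    by (rule finite_subset[of _ "Pow (set (fam ?I))"]) (auto simp: rb_covers_def simp del: labelled_rb_simps)
  then have "rb_opt ?I \<le> rb_cost ?I F"
    unfolding rb_opt_def using F by (intro Min_le) auto
  also have "rb_cost ?I F \<le> card V"
    unfolding rb_cost_def using assms(2) by (intro card_mono finite_subset[OF assms(2)]) (auto simp: F_def)
  finally show "rb_opt ?I \<le> card V" .
qed

text \<open>A set of the instance has a single blue element, so a cover needs an edge for every
  label. These are \<open>2 ^ lg n \<ge> n\<close> different edges, all inside the red vertices of
  the cover.\<close>

lemma accepts_cover:
  assumes E: "E \<subseteq> Pow {..<n}"
    and Fs: "set Fs \<in> rb_covers (labelled_rb n (edge_list n E) cs)"
    and cost: "rb_cost (labelled_rb n (edge_list n E) cs) (set Fs) ^ c \<le> n ^ (c - 1)"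
  shows "accepts c (enc_hypergraph n k E) (enc_list (map enc_set Fs))"
proof -
  let ?I = "labelled_rb n (edge_list n E) cs"
  have fin: "finite S" if "S \<in> set Fs" for S
    using that Fs by (fastforce simp: rb_covers_def)
  \<comment> \<open>A unary code has its number as length, so the check sees exactly the elements of
    the chosen sets.\<close>
  have occ: "occurs (enc_list (map enc_set Fs)) = \<Union>(set Fs)"
  proof -
    have "occurs (enc_list (map enc_set Fs)) = (\<Union>S\<in>set Fs. {length (dl t) |t. t \<in> set (dl (enc_set S))})"
      by (auto simp: occurs_def)
    also have "\<dots> = (\<Union>S\<in>set Fs. S)"
    proof (intro SUP_cong refl)
      fix S assume "S \<in> set Fs"
      then have S: "set (dl (enc_set S)) = enc_nat ` S" using fin by (simp add: enc_set_def)
      have "{length (dl t) |t. t \<in> enc_nat ` S} = (\<lambda>v. length (dl (enc_nat v))) ` S" by blast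
      then show "{length (dl t) |t. t \<in> set (dl (enc_set S))} = S" unfolding S by simp
    qed
    finally show ?thesis by simp
  qed
  let ?sel = "{e \<in> E. e \<subseteq> \<Union>(set Fs)}"
  \<comment> \<open>The label of an edge is well defined because the edge list has no
    repetitions.\<close>
  define lab where "lab e = (THE c. \<exists>vs. (vs, c) \<in> set (zip (edge_list n E) cs) \<and> set vs = e)" for e
  have lab: "lab (set vs) = c" if "(vs, c) \<in> set (zip (edge_list n E) cs)" for vs c
    unfolding lab_def
  proof (rule the_equality)
    fix d assume "\<exists>ws. (ws, d) \<in> set (zip (edge_list n E) cs) \<and> set ws = set vs"
    then obtain ws where ws: "(ws, d) \<in> set (zip (edge_list n E) cs)" "set ws = set vs" by blast
    obtain i where i: "i < length (edge_list n E)" "i < length cs" "vs = edge_list n E ! i" "c = cs ! i"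
      using \<open>(vs, c) \<in> _\<close> by (auto simp: in_set_zip)
    obtain j where j: "j < length (edge_list n E)" "j < length cs" "ws = edge_list n E ! j" "d = cs ! j"
      using ws by (auto simp: in_set_zip)
    have "map set (edge_list n E) ! i = map set (edge_list n E) ! j" using i j ws by simp
    then have "i = j" using distinct_set_edge_list[of n E] i j nth_eq_iff_index_eq by fastforce
    then show "d = c" using i j by simp
  qed (use that in blast)
  have "{..<2 ^ lg n} \<subseteq> lab ` ?sel"
  proof
    fix j :: nat assume "j \<in> {..<2 ^ lg n}"
    then have "n + j \<in> blue ?I" by simp
    moreover have "blue ?I \<subseteq> \<Union>(set Fs)" "set Fs \<subseteq> set (fam ?I)"
      using Fs unfolding rb_covers_def by blast+
    ultimately obtain S where S: "S \<in> set Fs" "n + j \<in> S" "S \<in> set (fam ?I)" by blast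
    then obtain vs d where v: "S = insert (n + d) (set vs)" "(vs, d) \<in> set (zip (edge_list n E) cs)"
      unfolding labelled_rb_simps by blast
    have vs: "set vs \<subseteq> {..<n}" "set vs \<in> E" using v(2) edge_list_sorted set_zip_leftD by metis+
    then have "d = j" using S(2) v(1) by auto
    then show "j \<in> lab ` ?sel" using lab[OF v(2)] vs v(1) S(1) by blast
  qed
  moreover have "finite E" using E finite_subset by blast
  ultimately have "2 ^ lg n \<le> card ?sel"
    using surj_card_le[of ?sel "{..<2 ^ lg n}" lab] by simp
  then have "n \<le> card ?sel" using le_two_power_lg[of n] by linarith
  then show ?thesis
    using cost unfolding accepts_enc_hypergraph[OF E] occ by (simp add: rb_cost_def)
qed

section \<open>One trial on sparse and on dense hypergraphs\<close>

lemma size_enc_hypergraph: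
  assumes "E \<subseteq> Pow {..<n}" shows "n \<le> size (enc_hypergraph n k E)" "card E \<le> size (enc_hypergraph n k E)"
proof -
  have "size (enc_hypergraph n k E) = 3 + n + k + size (enc_edges (edge_list n E))"
    by (simp add: enc_hypergraph_eq)
  moreover have "card E \<le> size (enc_edges (edge_list n E))"
    using length_dl_le[of "enc_edges (edge_list n E)"] length_edge_list[OF assms] by (simp add: enc_edges_def)
  ultimately show "n \<le> size (enc_hypergraph n k E)" "card E \<le> size (enc_hypergraph n k E)" by auto
qed

text \<open>Acceptance always exhibits too many edges or a small vertex set spanning n edges. So the
  trial rejects whatever \<open>A\<close> answers, even on an infeasible instance.\<close>

lemma pmf_trial_random:
  assumes E: "E \<subseteq> Pow {..<n}" "\<not> n ^ (2 * c + 1) < card E ^ c"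
    and sparse: "\<And>Q. Q \<subseteq> {..<n} \<Longrightarrow> card Q ^ c \<le> n ^ (c - 1) \<Longrightarrow> card {e \<in> E. e \<subseteq> Q} < n"
  shows "pmf (trial c A (enc_hypergraph n k E)) Tip = 1"
proof -
  have "\<not> accepts c (enc_hypergraph n k E) z" for z
  proof
    assume "accepts c (enc_hypergraph n k E) z"
    then have "card ({..<n} \<inter> occurs z) ^ c \<le> n ^ (c - 1)" "n \<le> card {e \<in> E. e \<subseteq> occurs z}"
      using E(2) unfolding accepts_enc_hypergraph[OF E(1)] by blast+
    \<comment> \<open>Codes of blue elements or of no element at all change nothing, as edges lie in
      \<open>{..<n}\<close>.\<close>
    moreover have "{e \<in> E. e \<subseteq> occurs z} = {e \<in> E. e \<subseteq> {..<n} \<inter> occurs z}" using E(1) by auto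
    ultimately show False using sparse[of "{..<n} \<inter> occurs z"] by auto
  qed
  then show ?thesis by (simp add: trial_def map_pmf_const)
qed

text \<open>The bound is 1/4 + 1/3: either some label is missing inside \<open>V\<close>, or the
  approximation algorithm fails. Hypergraphs with too many edges are accepted outright, so the ratio
  is constrained only below that threshold. Nothing forces \<open>\<rho>\<close> to be nonnegative,
  hence the absolute value.\<close>

lemma pmf_trial_dense:
  assumes A: "rb_approximates A \<rho>" and E: "E \<subseteq> Pow {..<n}" and V: "V \<subseteq> {..<n}"
    and hit: "2 ^ lg n * (1 - 1 / 2 ^ lg n) ^ card {e \<in> E. e \<subseteq> V} \<le> (1 / 4 :: real)"
    and ratio: "card E ^ c \<le> n ^ (2 * c + 1) \<Longrightarrow> (\<bar>\<rho> (card E) (2 ^ lg n)\<bar> * real (card V)) ^ c \<le> real n ^ (c - 1)"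
  shows "pmf (trial c A (enc_hypergraph n k E)) Tip \<le> 7 / 12"
proof (cases "n ^ (2 * c + 1) < card E ^ c")
  case True
  then have "accepts c (enc_hypergraph n k E) z" for z
    using accepts_enc_hypergraph[OF E] by blast
  then show ?thesis by (simp add: trial_def map_pmf_const)
next
  case False
  let ?x = "enc_hypergraph n k E" and ?es = "edge_list n E"
  let ?cs = "\<lambda>bs. labels (lg n) (length ?es) bs"
  let ?N = "size ?x ^ 2"
  let ?bad = "{bs. \<not> complete_labels n ?es (\<lambda>vs. set vs \<subseteq> V) (?cs bs)}"
  have N: "length ?es * lg n \<le> ?N"
    unfolding length_edge_list[OF E] power2_eq_square
    using size_enc_hypergraph[OF E, of k] lg_le[of n] by (intro mult_mono) auto
  have ratio': "(\<bar>\<rho> (card E) (2 ^ lg n)\<bar> * real (card V)) ^ c \<le> real n ^ (c - 1)" using ratio False by simp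
  have good: "pmf (map_pmf (\<lambda>z. if accepts c ?x z then Bin Tip Tip else Tip) (A (instance_tree ?x (enc_bits bs)))) Tip \<le> 1 / 3"
    if bs: "length bs = ?N" "bs \<notin> ?bad" for bs
  proof -
    let ?I = "labelled_rb n ?es (?cs bs)"
    let ?Y = "{y. \<exists>Fs. y = enc_list (map enc_set Fs) \<and> set Fs \<in> rb_covers ?I \<and>
             real (rb_cost ?I (set Fs)) \<le> \<rho> (length (fam ?I)) (card (blue ?I)) * real (rb_opt ?I)}"
    have cl: "complete_labels n ?es (\<lambda>vs. set vs \<subseteq> V) (?cs bs)" using bs by simp
    have "set (?cs bs) \<subseteq> {..<2 ^ lg n}" using set_labels_less[of ?es "lg n" bs] N bs by auto
    then have "rb_wf ?I" by (rule rb_wf_labelled_rb) simp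
    then have "2 / 3 \<le> measure_pmf.prob (A (enc_instance ?I)) ?Y"
      using A labelled_rb_cover(1)[OF cl V] unfolding rb_approximates_def by blast
    also have "\<dots> \<le> measure_pmf.prob (A (enc_instance ?I)) {z. accepts c ?x z}"
    proof (intro measure_pmf.finite_measure_mono)
      show "?Y \<subseteq> {z. accepts c ?x z}"
      proof
        fix y assume "y \<in> ?Y"
        then obtain Fs where Fs: "y = enc_list (map enc_set Fs)" "set Fs \<in> rb_covers ?I"
          "real (rb_cost ?I (set Fs)) \<le> \<rho> (card E) (2 ^ lg n) * real (rb_opt ?I)" 
          using length_edge_list[OF E] by auto
        have "\<rho> (card E) (2 ^ lg n) * real (rb_opt ?I) \<le> \<bar>\<rho> (card E) (2 ^ lg n)\<bar> * real (card V)"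
          using labelled_rb_cover(2)[OF cl V] by (intro mult_mono) auto
        then have "real (rb_cost ?I (set Fs)) ^ c \<le> (\<bar>\<rho> (card E) (2 ^ lg n)\<bar> * real (card V)) ^ c"
          using Fs(3) by (intro power_mono) auto
        also have "\<dots> \<le> real n ^ (c - 1)" by (rule ratio')
        finally have "rb_cost ?I (set Fs) ^ c \<le> n ^ (c - 1)" by (metis of_nat_le_iff of_nat_power)
        then show "y \<in> {z. accepts c ?x z}" using accepts_cover[OF E Fs(2)] Fs(1) by simp
      qed
    qed simp
    finally have "2 / 3 \<le> measure_pmf.prob (A (enc_instance ?I)) {z. accepts c ?x z}" .
    moreover have "pmf (map_pmf (\<lambda>z. if accepts c ?x z then Bin Tip Tip else Tip) (A (enc_instance ?I))) Tip =
        measure_pmf.prob (A (enc_instance ?I)) (- {z. accepts c ?x z})"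
      unfolding pmf_map by (intro arg_cong[where f = "measure_pmf.prob _"]) (auto split: if_splits)
    moreover have "\<dots> = 1 - measure_pmf.prob (A (enc_instance ?I)) {z. accepts c ?x z}"
      by (simp add: measure_pmf.prob_compl[of "{z. accepts c ?x z}", simplified] Compl_eq_Diff_UNIV)
    ultimately show ?thesis using instance_tree_eq[of n E bs k] N bs by simp
  qed
  let ?f = "\<lambda>bs. pmf (map_pmf (\<lambda>z. if accepts c ?x z then Bin Tip Tip else Tip) (A (instance_tree ?x (enc_bits bs)))) Tip"
  have "pmf (trial c A ?x) Tip = measure_pmf.expectation (coins ?N) ?f"
    by (simp add: trial_def labelled_instance_def bind_map_pmf pmf_bind)
  \<comment> \<open>On bad coins the trivial bound 1 is used, on all others 1/3.\<close>
  also have "\<dots> \<le> measure_pmf.expectation (coins ?N) (\<lambda>bs. indicator ?bad bs + 1 / 3)"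
  proof (intro integral_mono_AE)
    show "AE bs in measure_pmf (coins ?N). ?f bs \<le> indicator ?bad bs + 1 / 3"
    proof (rule AE_pmfI)
      fix bs assume bs: "bs \<in> set_pmf (coins ?N)"
      have "?f bs \<le> 1" by (rule pmf_le_1)
      then show "?f bs \<le> indicator ?bad bs + 1 / 3"
        using good[of bs] bs by (cases "bs \<in> ?bad") (simp_all del: pmf_le_1)
    qed
    show "integrable (measure_pmf (coins ?N)) ?f"
      by (rule measure_pmf.integrable_const_bound[where B = 1]) (auto simp: pmf_le_1)
    show "integrable (measure_pmf (coins ?N)) (\<lambda>bs. indicator ?bad bs + 1 / 3 :: real)"
      by (rule measure_pmf.integrable_const_bound[where B = 2]) (auto simp: indicator_def)
  qed
  also have "\<dots> = measure_pmf.prob (coins ?N) ?bad + 1 / 3"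
    by (subst Bochner_Integration.integral_add) (auto intro!: measure_pmf.integrable_const_bound[where B = 1])
  also have "measure_pmf.prob (coins ?N) ?bad \<le> 1 / 4"
  proof -
    have "measure_pmf.prob (coins ?N) ?bad \<le> 2 ^ lg n * (1 - 1 / 2 ^ lg n) ^ length (filter (\<lambda>vs. set vs \<subseteq> V) ?es)"
      by (rule prob_not_complete_labels[OF N])
    also have "length (filter (\<lambda>vs. set vs \<subseteq> V) ?es) = card {e \<in> E. e \<subseteq> V}"
      by (rule length_filter_edge_list[OF E])
    finally show ?thesis using hit by linarith
  qed
  finally show ?thesis by simp
qed

section \<open>Random hypergraphs\<close>

lemma finite_all_edges: "finite (all_edges r n)"
  by (rule finite_subset[of _ "Pow {..<n}"]) (auto simp: all_edges_def)

lemma all_edges_subset_Pow: "all_edges r n \<subseteq> Pow {..<n}"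
  by (auto simp: all_edges_def)

lemma card_subsets_le_power:
  assumes "finite Q" shows "card {e. e \<subseteq> Q \<and> card e = r} \<le> card Q ^ r"
proof (cases "r \<le> card Q")
  case True
  then show ?thesis using assms by (simp add: n_subsets binomial_le_pow)
next
  case False
  then show ?thesis using assms by (simp add: n_subsets binomial_eq_0)
qed

lemma set_random_hypergraph: "set_pmf (random_hypergraph r n p) \<subseteq> Pow (all_edges r n)"
  by (auto simp: random_hypergraph_def)

lemma prob_random_hypergraph_superset:
  assumes "T \<subseteq> all_edges r n" "0 \<le> p" "p \<le> 1"
  shows "measure_pmf.prob (random_hypergraph r n p) {E. T \<subseteq> E} = p ^ card T"
proof -
  let ?U = "all_edges r n"
  have "measure_pmf.prob (random_hypergraph r n p) {E. T \<subseteq> E} =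
     measure_pmf.prob (Pi_pmf ?U False (\<lambda>_. bernoulli_pmf p)) (Pi ?U (\<lambda>e. if e \<in> T then {True} else UNIV))"
    unfolding random_hypergraph_def measure_map_pmf
    using assms(1) by (intro arg_cong[where f = "measure_pmf.prob _"]) (auto simp: Pi_def split: if_splits)
  also have "\<dots> = (\<Prod>e\<in>?U. measure_pmf.prob (bernoulli_pmf p) (if e \<in> T then {True} else UNIV))"
    by (rule measure_Pi_pmf_Pi[OF finite_all_edges])
  also have "\<dots> = (\<Prod>e\<in>?U. if e \<in> T then p else 1)"
    using assms by (intro prod.cong refl) (auto simp: measure_pmf_single)
  also have "\<dots> = (\<Prod>e\<in>?U \<inter> T. p)"
    by (rule prod.inter_restrict[OF finite_all_edges, symmetric])
  also have "?U \<inter> T = T" using assms(1) by auto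
  finally show ?thesis by simp
qed

text \<open>Markov's inequality: the expected number of edges is at most
  \<open>real n ^ r * p\<close>.\<close>

lemma prob_random_hypergraph_large:
  assumes "0 \<le> p" "p \<le> 1" "0 < M"
  shows "measure_pmf.prob (random_hypergraph r n p) {E. M \<le> real (card E)} \<le> real n ^ r * p / M"
proof -
  let ?H = "random_hypergraph r n p" and ?U = "all_edges r n"
  have "M * measure_pmf.prob ?H {E. M \<le> real (card E)} = 
      measure_pmf.expectation ?H (\<lambda>E. M * indicator {E. M \<le> real (card E)} E)"
    by simp
  also have "\<dots> \<le> measure_pmf.expectation ?H (\<lambda>E. \<Sum>e\<in>?U. indicator {E. {e} \<subseteq> E} E)"
  proof (intro integral_mono_AE)
    show "AE E in measure_pmf ?H. M * indicator {E. M \<le> real (card E)} E \<le> (\<Sum>e\<in>?U. indicator {E. {e} \<subseteq> E} E)"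
    proof (rule AE_pmfI)
      fix E assume "E \<in> set_pmf ?H"
      then have E: "E \<subseteq> ?U" using set_random_hypergraph by blast
      have "(\<Sum>e\<in>?U. indicator {E. {e} \<subseteq> E} E) = (\<Sum>e\<in>?U. if e \<in> E then 1 else (0::real))"
        by (intro sum.cong) (auto simp: indicator_def)
      also have "\<dots> = real (card E)"
        using E finite_all_edges by (simp add: sum.inter_restrict[symmetric] Int_absorb1)
      finally show "M * indicator {E. M \<le> real (card E)} E \<le> (\<Sum>e\<in>?U. indicator {E. {e} \<subseteq> E} E :: real)"
        by (auto simp: indicator_def)
    qed
    show "integrable (measure_pmf ?H) (\<lambda>E. M * indicator {E. M \<le> real (card E)} E)"
      using assms by (intro measure_pmf.integrable_const_bound[where B = M]) (auto simp: indicator_def)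
    show "integrable (measure_pmf ?H) (\<lambda>E. \<Sum>e\<in>?U. indicator {E. {e} \<subseteq> E} E :: real)"
      by (intro Bochner_Integration.integrable_sum measure_pmf.integrable_const_bound[where B = 1]) auto
  qed
  also have "\<dots> = (\<Sum>e\<in>?U. measure_pmf.prob ?H {E. {e} \<subseteq> E})"
    by (subst Bochner_Integration.integral_sum) (auto intro!: measure_pmf.integrable_const_bound[where B = 1] simp del: insert_subset)
  also have "\<dots> = (\<Sum>e\<in>?U. p)"
    using assms by (intro sum.cong refl, subst prob_random_hypergraph_superset) auto
  also have "\<dots> \<le> real n ^ r * p"
  proof -
    have "card ?U \<le> n ^ r" using card_subsets_le_power[of "{..<n}" r] by (simp add: all_edges_def)
    then have "real (card ?U) \<le> real n ^ r" by (metis of_nat_le_iff of_nat_power)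
    then show ?thesis using assms by (simp add: mult_right_mono)
  qed
  finally show ?thesis using assms by (simp add: field_simps)
qed

text \<open>Union bound over at most \<open>2 ^ n\<close> vertex sets and, inside each, over at most
  \<open>(q ^ r) ^ t\<close> sets of t possible edges, each of them fully present with probability
  \<open>p ^ t\<close>.\<close>

lemma prob_random_hypergraph_dense_spot:
  fixes q :: real
  assumes "0 \<le> p" "p \<le> 1" "0 \<le> q"
  shows "measure_pmf.prob (random_hypergraph r n p) {E. \<exists>Q \<subseteq> {..<n}. real (card Q) \<le> q \<and> t \<le> card {e \<in> E. e \<subseteq> Q}}
     \<le> 2 ^ n * (q ^ r * p) ^ t"
proof -
  let ?H = "random_hypergraph r n p" and ?U = "all_edges r n"
  define Qs where "Qs = {Q. Q \<subseteq> {..<n} \<and> real (card Q) \<le> q}"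
  define Ts where "Ts Q = {T. T \<subseteq> {e. e \<subseteq> Q \<and> card e = r} \<and> card T = t}" for Q :: "nat set"
  have finQ: "finite Q" if "Q \<in> Qs" for Q using that finite_subset by (auto simp: Qs_def)
  have finQs: "finite Qs" by (rule finite_subset[of _ "Pow {..<n}"]) (auto simp: Qs_def)
  have finT: "finite (Ts Q)" if "Q \<in> Qs" for Q
    by (rule finite_subset[of _ "Pow (Pow Q)"]) (use finQ[OF that] in \<open>auto simp: Ts_def\<close>)
  have cardT: "real (card (Ts Q)) \<le> (q ^ r) ^ t" if "Q \<in> Qs" for Q
  proof -
    have fin: "finite {e. e \<subseteq> Q \<and> card e = r}" using finQ[OF that] by simp
    have "card (Ts Q) \<le> card {e. e \<subseteq> Q \<and> card e = r} ^ t"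
      unfolding Ts_def by (rule card_subsets_le_power[OF fin])
    also have "\<dots> \<le> (card Q ^ r) ^ t" by (intro power_mono card_subsets_le_power finQ that) auto
    finally have "real (card (Ts Q)) \<le> (real (card Q) ^ r) ^ t" by (metis of_nat_le_iff of_nat_power)
    also have "\<dots> \<le> (q ^ r) ^ t" using that by (intro power_mono) (auto simp: Qs_def)
    finally show ?thesis .
  qed
  have probT: "measure_pmf.prob ?H {E. T \<subseteq> E} \<le> p ^ t" if "Q \<in> Qs" "T \<in> Ts Q" for Q T
  proof -
    have "T \<subseteq> ?U" using that by (auto simp: Qs_def Ts_def all_edges_def)
    then show ?thesis using prob_random_hypergraph_superset assms that by (simp add: Ts_def)
  qed
  \<comment> \<open>Restricting to the support makes all edges r-subsets, the only ones counted in
    \<open>Ts\<close>.\<close>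
  have "measure_pmf.prob ?H {E. \<exists>Q \<subseteq> {..<n}. real (card Q) \<le> q \<and> t \<le> card {e \<in> E. e \<subseteq> Q}} =
      measure_pmf.prob ?H ({E. \<exists>Q \<subseteq> {..<n}. real (card Q) \<le> q \<and> t \<le> card {e \<in> E. e \<subseteq> Q}} \<inter> set_pmf ?H)"
    by (simp add: measure_Int_set_pmf)
  also have "\<dots> \<le> measure_pmf.prob ?H (\<Union>Q\<in>Qs. \<Union>T\<in>Ts Q. {E. T \<subseteq> E})"
  proof (intro measure_pmf.finite_measure_mono)
    show "{E. \<exists>Q \<subseteq> {..<n}. real (card Q) \<le> q \<and> t \<le> card {e \<in> E. e \<subseteq> Q}} \<inter> set_pmf ?H 
        \<subseteq> (\<Union>Q\<in>Qs. \<Union>T\<in>Ts Q. {E. T \<subseteq> E})"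
    proof safe
      fix E Q assume E: "E \<in> set_pmf ?H" and Q: "Q \<subseteq> {..<n}" "real (card Q) \<le> q" "t \<le> card {e \<in> E. e \<subseteq> Q}"
      obtain T where T: "T \<subseteq> {e \<in> E. e \<subseteq> Q}" "card T = t" 
        using obtain_subset_with_card_n[OF Q(3)] by blast
      have "E \<subseteq> ?U" using E set_random_hypergraph by blast
      then have "T \<in> Ts Q" using T by (auto simp: Ts_def all_edges_def)
      then show "E \<in> (\<Union>Q\<in>Qs. \<Union>T\<in>Ts Q. {E. T \<subseteq> E})" using T Q by (auto simp: Qs_def)
    qed
  qed simp
  also have "\<dots> \<le> (\<Sum>Q\<in>Qs. measure_pmf.prob ?H (\<Union>T\<in>Ts Q. {E. T \<subseteq> E}))"
    by (intro measure_pmf.finite_measure_subadditive_finite finQs) auto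
  also have "\<dots> \<le> (\<Sum>Q\<in>Qs. (q ^ r * p) ^ t)"
  proof (intro sum_mono)
    fix Q assume Q: "Q \<in> Qs"
    have "measure_pmf.prob ?H (\<Union>T\<in>Ts Q. {E. T \<subseteq> E}) \<le> (\<Sum>T\<in>Ts Q. measure_pmf.prob ?H {E. T \<subseteq> E})"
      by (intro measure_pmf.finite_measure_subadditive_finite finT Q) auto
    also have "\<dots> \<le> (\<Sum>T\<in>Ts Q. p ^ t)" by (intro sum_mono probT[OF Q])
    also have "\<dots> \<le> (q ^ r) ^ t * p ^ t" using cardT[OF Q] assms by (simp add: mult_right_mono)
    finally show "measure_pmf.prob ?H (\<Union>T\<in>Ts Q. {E. T \<subseteq> E}) \<le> (q ^ r * p) ^ t" by (simp add: power_mult_distrib)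
  qed
  also have "\<dots> \<le> 2 ^ n * (q ^ r * p) ^ t"
  proof -
    have "card Qs \<le> card (Pow {..<n})" by (intro card_mono) (auto simp: Qs_def)
    then have "real (card Qs) \<le> real (2 ^ n)" by (simp only: of_nat_le_iff card_Pow finite_lessThan card_lessThan)
    then show ?thesis using assms by (simp add: mult_right_mono)
  qed
  finally show ?thesis .
qed

text \<open>Double counting of incidences: an edge inside \<open>V\<close> contributes to the
  degrees of exactly r vertices of \<open>V\<close>.\<close>

lemma card_induced_ge:
  assumes "E \<subseteq> all_edges r n" "V \<subseteq> {..<n}" "average_degree V (induced E V) \<ge> d"
  shows "d * real (card V) \<le> real r * real (card {e \<in> E. e \<subseteq> V})"
proof (cases "card V = 0")
  case False
  have fin: "finite V" "finite {e \<in> E. e \<subseteq> V}"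
    using assms finite_subset finite_all_edges[of r n] by (auto intro: finite_subset[of _ "all_edges r n"] finite_subset[of _ "{..<n}"])
  have "(\<Sum>v\<in>V. card {e \<in> induced E V. v \<in> e}) = (\<Sum>e\<in>{e \<in> E. e \<subseteq> V}. card {v \<in> V. v \<in> e})"
    using sum_multicount_gen[of V "{e \<in> E. e \<subseteq> V}" "\<lambda>v e. v \<in> e" "\<lambda>e. card {v \<in> V. v \<in> e}"] fin
    by (simp add: induced_def conj_ac)
  also have "\<dots> = (\<Sum>e\<in>{e \<in> E. e \<subseteq> V}. r)"
  proof (intro sum.cong refl)
    fix e assume "e \<in> {e \<in> E. e \<subseteq> V}"
    then have "{v \<in> V. v \<in> e} = e" "card e = r" using assms by (auto simp: all_edges_def)
    then show "card {v \<in> V. v \<in> e} = r" by simp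
  qed
  finally have "(\<Sum>v\<in>V. real (card {e \<in> induced E V. v \<in> e})) = real r * real (card {e \<in> E. e \<subseteq> V})"
    by (simp flip: of_nat_sum of_nat_mult add: mult.commute)
  then show ?thesis using assms(3) False by (simp add: average_degree_def field_simps)
qed simp

section \<open>Asymptotics\<close>

text \<open>The capped loss \<open>e\<close> keeps the exponent \<open>1 / 4 - e\<close> positive,
  so that the power of m also dominates the 1 in the maximum.\<close>

lemma rb_ratio_le:
  fixes m L :: nat and x e s :: real
  assumes "0 < e" "e \<le> 1 / 8" "e \<le> \<epsilon>" "1 \<le> m" "real m \<le> x powr s" "3 \<le> L"
  shows "rb_ratio \<epsilon> m L \<le> x powr (s * (1 / 4 - e))"
proof -
  \<comment> \<open>As \<open>L \<ge> 3\<close> exceeds Euler's number, dividing by the squared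
    logarithm does not increase the quotient.\<close>
  have "1 \<le> ln (real L)"
    using exp_le assms(6) by (subst ln_ge_iff) auto
  then have "1 \<le> (ln (real L))\<^sup>2" by (simp add: one_le_power)
  then have "real m powr (1 / 4 - \<epsilon>) / (ln (real L))\<^sup>2 \<le> real m powr (1 / 4 - \<epsilon>)"
    by (simp add: divide_le_eq mult_le_cancel_left1 not_less)
  also have "\<dots> \<le> real m powr (1 / 4 - e)" using assms by (intro powr_mono) auto
  finally have 1: "real m powr (1 / 4 - \<epsilon>) / (ln (real L))\<^sup>2 \<le> real m powr (1 / 4 - e)" .
  have 2: "real m powr (1 / 4 - e) \<le> (x powr s) powr (1 / 4 - e)"
    using assms by (intro powr_mono2) auto
  have "1 \<le> real m powr (1 / 4 - e)" using assms by (intro ge_one_powr_ge_zero) auto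
  with 1 2 show ?thesis by (simp add: rb_ratio_def powr_powr)
qed

text \<open>With a planted size of at most sqrt n, the size condition of the conjecture holds for
  every planted log-density between 0 and \<alpha>.\<close>

definition floor_sqrt_real :: "nat \<Rightarrow> nat" where
  "floor_sqrt_real n = nat \<lfloor>sqrt (real n)\<rfloor>"

lemma floor_sqrt_real_bounds:
  "real (floor_sqrt_real n) \<le> sqrt (real n)" "sqrt (real n) - 1 \<le> real (floor_sqrt_real n)"
proof -
  have "0 \<le> \<lfloor>sqrt (real n)\<rfloor>" by simp
  then have "real (floor_sqrt_real n) = of_int \<lfloor>sqrt (real n)\<rfloor>"
    by (simp add: floor_sqrt_real_def)
  then show "real (floor_sqrt_real n) \<le> sqrt (real n)" "sqrt (real n) - 1 \<le> real (floor_sqrt_real n)"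
    by linarith+
qed

text \<open>By \<open>1 - x \<le> exp (- x)\<close>, K edges miss a fixed label with probability at
  most \<open>exp (- K / L)\<close>, and \<open>L \<le> 2 * n\<close>. A value of \<kappa> slightly
  above ln n is enough.\<close>

lemma hit_probability:
  fixes K :: nat and \<kappa> :: real
  assumes "0 < n" "2 * real n * \<kappa> \<le> real K" "0 \<le> \<kappa>" "2 * real n * exp (- \<kappa>) \<le> 1 / 4"
  shows "2 ^ lg n * (1 - 1 / 2 ^ lg n) ^ K \<le> (1 / 4 :: real)"
proof -
  define L :: real where "L = 2 ^ lg n"
  have L: "1 \<le> L" by (simp add: L_def)
  have "real (2 ^ lg n) \<le> real (2 * n)" using two_power_lg_le[OF assms(1)] by (simp only: of_nat_le_iff)
  then have Ln: "L \<le> 2 * real n" by (simp add: L_def)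
  have "(1 - 1 / L) ^ K \<le> exp (- (1 / L)) ^ K"
    using L exp_ge_add_one_self[of "- (1 / L)"] by (intro power_mono) auto
  also have "\<dots> = exp (- (real K / L))" by (simp flip: exp_of_nat_mult)
  also have "\<dots> \<le> exp (- \<kappa>)"
  proof -
    have "\<kappa> * L \<le> \<kappa> * (2 * real n)" using Ln assms by (intro mult_left_mono) auto
    then have "\<kappa> \<le> real K / L" using L assms by (simp add: pos_le_divide_eq algebra_simps)
    then show ?thesis by simp
  qed
  finally have "L * (1 - 1 / L) ^ K \<le> (2 * real n) * exp (- \<kappa>)"
    using L Ln by (intro mult_mono) auto
  then show ?thesis using assms unfolding L_def by linarith
qed

text \<open>The planted part has at least \<open>k powr (1 + \<beta>) / r\<close> edges. The
  constant \<open>16 * r\<close> collects a factor 8 for replacing k by \<open>sqrt n / 2\<close>,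
  the r incidences of an edge, and the factor 2 in front, which is there for
  \<open>L \<le> 2 * n\<close>.\<close>

lemma many_planted_edges:
  fixes g :: real
  assumes "0 < g" "g \<le> 1" "16 \<le> n" "1 + g / 4 \<le> \<beta>" "0 < r"
    and E: "E \<subseteq> all_edges r n" "V \<subseteq> {..<n}" "card V = floor_sqrt_real n"
      "average_degree V (induced E V) \<ge> real (floor_sqrt_real n) powr \<beta>"
  shows "2 * real n * (real n powr (g / 8) / (16 * real r)) \<le> real (card {e \<in> E. e \<subseteq> V})"
proof -
  let ?k = "real (floor_sqrt_real n)"
  \<comment> \<open>From \<open>n \<ge> 16\<close> on, sqrt n - 1 is at least half of sqrt n, so
    rounding down costs at most a factor 2.\<close>
  have "4 \<le> sqrt (real n)" using assms(3) by (intro real_le_rsqrt) auto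
  then have k: "sqrt (real n) / 2 \<le> ?k" "1 \<le> ?k" using floor_sqrt_real_bounds(2)[of n] by linarith+
  have "real n powr (1 + g / 8) / 8 \<le> (sqrt (real n) / 2) powr (2 + g / 4)"
  proof -
    have "(2::real) powr (2 + g / 4) \<le> 2 powr 3" using assms by (intro powr_mono) auto
    then have "(2::real) powr (2 + g / 4) \<le> 8" by simp
    moreover have "sqrt (real n) powr (2 + g / 4) = real n powr (1 + g / 8)"
      by (simp add: powr_half_sqrt[symmetric] powr_powr algebra_simps)
    moreover have "real n powr (1 + g / 8) / 8 \<le> real n powr (1 + g / 8) / 2 powr (2 + g / 4)"
      using calculation(1) by (intro divide_left_mono) auto
    ultimately show ?thesis by (simp add: powr_divide)
  qed
  also have "\<dots> \<le> ?k powr (2 + g / 4)" using k assms by (intro powr_mono2) auto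
  also have "\<dots> \<le> ?k powr (1 + \<beta>)" using k assms by (intro powr_mono) auto
  also have "\<dots> = ?k powr \<beta> * ?k" using k by (simp add: powr_add)
  also have "\<dots> \<le> real r * real (card {e \<in> E. e \<subseteq> V})"
    using card_induced_ge[OF E(1,2,4)] E(3) by simp
  finally have "real n powr (1 + g / 8) / 8 \<le> real r * real (card {e \<in> E. e \<subseteq> V})" .
  moreover have "real n powr (1 + g / 8) = real n * real n powr (g / 8)"
    using assms(3) by (simp add: powr_add)
  ultimately have "real n * real n powr (g / 8) / 8 \<le> real r * real (card {e \<in> E. e \<subseteq> V})" by simp
  then show ?thesis using assms(5) by (simp add: field_simps)
qed

text \<open>Two exponents decide. The expected number of edges is at most
  \<open>n powr (2 + g / 2)\<close>, short of the threshold by a factor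
  \<open>n powr (g / 2)\<close>. Inside \<open>n powr (1 - g)\<close> vertices it is at most
  \<open>n powr (- 1 + g / 2)\<close>, because \<open>3 * c * g = 3\<close>.\<close>

lemma prob_random_hypergraph_bad:
  fixes n c :: nat
  defines "g \<equiv> 1 / real c"
  defines "H \<equiv> random_hypergraph (3 * c) n (real n powr (1 + g / 2 - (real (3 * c) - 1)))"
  assumes "1 \<le> c" "16 \<le> n"
  shows "measure_pmf.prob H {E. real n powr (2 + g) \<le> real (card E)} \<le> real n powr (- (g / 2))"
    and "measure_pmf.prob H {E. \<exists>Q \<subseteq> {..<n}. real (card Q) \<le> real n powr (1 - g) \<and> n \<le> card {e \<in> E. e \<subseteq> Q}}
      \<le> (1 / 2) ^ n"
proof -
  let ?p = "real n powr (1 + g / 2 - (real (3 * c) - 1))"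
  have g: "0 < g" "g \<le> 1" "g * real c = 1" using assms(3) by (auto simp: g_def)
  have p: "0 \<le> ?p" "?p \<le> 1"
    using g assms(3,4) powr_mono[of "1 + g / 2 - (real (3 * c) - 1)" 0 "real n"] by auto
  have "measure_pmf.prob H {E. real n powr (2 + g) \<le> real (card E)} \<le> real n ^ (3 * c) * ?p / real n powr (2 + g)"
    unfolding H_def using assms(4) by (intro prob_random_hypergraph_large p) auto
  also have "real n ^ (3 * c) = real n powr (real (3 * c))" using assms(4) by (subst powr_realpow) auto
  also have "real n powr (real (3 * c)) * ?p / real n powr (2 + g) = real n powr (- (g / 2))"
    unfolding powr_add[symmetric] powr_diff[symmetric] by (simp add: field_simps)
  finally show "measure_pmf.prob H {E. real n powr (2 + g) \<le> real (card E)} \<le> real n powr (- (g / 2))" .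
  have "measure_pmf.prob H {E. \<exists>Q \<subseteq> {..<n}. real (card Q) \<le> real n powr (1 - g) \<and> n \<le> card {e \<in> E. e \<subseteq> Q}}
      \<le> 2 ^ n * ((real n powr (1 - g)) ^ (3 * c) * ?p) ^ n"
    unfolding H_def by (intro prob_random_hypergraph_dense_spot p) auto
  also have "(real n powr (1 - g)) ^ (3 * c) * ?p = real n powr (real (3 * c) * (1 - g) + (1 + g / 2 - (real (3 * c) - 1)))"
    unfolding powr_add using assms(4) by (simp add: powr_power)
  also have "real (3 * c) * (1 - g) + (1 + g / 2 - (real (3 * c) - 1)) = - 1 + g / 2"
    using g(3) by (simp add: algebra_simps)
  also have "2 ^ n * (real n powr (- 1 + g / 2)) ^ n = (2 * real n powr (- 1 + g / 2)) ^ n"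
    by (simp add: power_mult_distrib)
  also have "\<dots> \<le> (1 / 2) ^ n"
  proof (intro power_mono)
    \<comment> \<open>The power is at most \<open>16 powr (- 1 / 2) = 1 / 4\<close>, which leaves
      1/2 after the factor 2 contributed by the choice of the vertex set.\<close>
    have "real n powr (- 1 + g / 2) \<le> real n powr (- (1 / 2))" using assms(4) g by (intro powr_mono) auto
    also have "\<dots> \<le> 16 powr (- (1 / 2))" using assms(4) by (intro powr_mono2') auto
    also have "(16 :: real) powr (- (1 / 2)) = 1 / 4"
      by (simp add: powr_minus powr_half_sqrt real_sqrt_unique[of 4 16, simplified] field_simps)
    finally show "2 * real n powr (- 1 + g / 2) \<le> 1 / 2" by simp
  qed auto
  finally show "measure_pmf.prob H {E. \<exists>Q \<subseteq> {..<n}. real (card Q) \<le> real n powr (1 - g) \<and> n \<le> card {e \<in> E. e \<subseteq> Q}}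
      \<le> (1 / 2) ^ n" .
qed

section \<open>The amplified trial solves Dense-vs-Random\<close>

lemma powr_two_plus_power:
  assumes "g * real c = 1" "0 < n"
  shows "(real n powr (2 + g)) ^ c = real n ^ (2 * c + 1)"
proof -
  have "(real n powr (2 + g)) ^ c = real n powr ((2 + g) * real c)"
    using assms(2) by (simp add: powr_power mult.commute)
  also have "(2 + g) * real c = real (2 * c + 1)" using assms(1) by (simp add: algebra_simps)
  also have "real n powr real (2 * c + 1) = real n ^ (2 * c + 1)" using assms(2) by (intro powr_realpow) simp
  finally show ?thesis .
qed

lemma powr_one_minus_power:
  assumes "g * real c = 1" "1 \<le> c" "0 < n"
  shows "(real n powr (1 - g)) ^ c = real n ^ (c - 1)"
proof -
  have "(real n powr (1 - g)) ^ c = real n powr ((1 - g) * real c)"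
    using assms(3) by (simp add: powr_power mult.commute)
  also have "(1 - g) * real c = real (c - 1)" using assms by (simp add: algebra_simps of_nat_diff)
  also have "real n powr real (c - 1) = real n ^ (c - 1)" using assms(3) by (intro powr_realpow) simp
  finally show ?thesis .
qed

text \<open>Outside two rare events the trial rejects with certainty, and certainty survives any
  number of repetitions.\<close>

lemma solves_random:
  assumes c: "1 \<le> c" and D: "\<And>x. pmf (D x) Tip = pmf (trial c A x) Tip ^ size x"
  shows "(\<lambda>n. measure_pmf.prob (bind_pmf (random_hypergraph (3 * c) n 
       (real n powr (1 + 1 / real c / 2 - (real (3 * c) - 1))))
       (\<lambda>E. D (enc_hypergraph n (k n) E))) {Tip}) \<longlonglongrightarrow> 1"
proof -
  define g where "g = 1 / real c"
  have g: "0 < g" "g \<le> 1" "g * real c = 1" using c by (auto simp: g_def)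
  define H where "H n = random_hypergraph (3 * c) n (real n powr (1 + g / 2 - (real (3 * c) - 1)))" for n
  define B1 where "B1 n = {E :: nat set set. real n powr (2 + g) \<le> real (card E)}" for n :: nat
  define B2 where "B2 n = {E. \<exists>Q \<subseteq> {..<n}. real (card Q) \<le> real n powr (1 - g) \<and> n \<le> card {e \<in> E. e \<subseteq> Q}}" for n :: nat
  have good: "pmf (D (enc_hypergraph n (k n) E)) Tip = 1" 
    if "E \<in> set_pmf (H n)" "E \<notin> B1 n" "E \<notin> B2 n" "16 \<le> n" for E n
  proof -
    have E: "E \<subseteq> Pow {..<n}" using that(1) set_random_hypergraph all_edges_subset_Pow unfolding H_def by blast
    have "pmf (trial c A (enc_hypergraph n (k n) E)) Tip = 1"
    proof (rule pmf_trial_random[OF E])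
      have "(real n powr (2 + g)) ^ c = real n ^ (2 * c + 1)"
        using that(4) by (intro powr_two_plus_power g) simp
      moreover have "real (card E) ^ c \<le> (real n powr (2 + g)) ^ c"
        using that(2) by (intro power_mono) (auto simp: B1_def)
      ultimately have "card E ^ c \<le> n ^ (2 * c + 1)" by (metis of_nat_le_iff of_nat_power)
      then show "\<not> n ^ (2 * c + 1) < card E ^ c" by simp
      fix Q assume Q: "Q \<subseteq> {..<n}" "card Q ^ c \<le> n ^ (c - 1)"
      have "(real n powr (1 - g)) ^ c = real n ^ (c - 1)"
        using that(4) by (intro powr_one_minus_power g c) simp
      moreover have "real (card Q) ^ c \<le> real n ^ (c - 1)" using Q(2) by (metis of_nat_le_iff of_nat_power)
      ultimately have "real (card Q) \<le> real n powr (1 - g)"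
        using c power_mono_iff[of "real (card Q)" "real n powr (1 - g)" c] by simp
      then show "card {e \<in> E. e \<subseteq> Q} < n" using that(3) Q(1) unfolding B2_def by (auto simp: not_le)
    qed
    then show ?thesis using D by simp
  qed
  have lower: "1 - (real n powr (- (g / 2)) + (1 / 2) ^ n) \<le> 
     measure_pmf.prob (bind_pmf (H n) (\<lambda>E. D (enc_hypergraph n (k n) E))) {Tip}" if n: "16 \<le> n" for n
  proof -
    let ?f = "\<lambda>E. pmf (D (enc_hypergraph n (k n) E)) Tip"
    have "measure_pmf.prob (H n) (B1 n \<union> B2 n) \<le> measure_pmf.prob (H n) (B1 n) + measure_pmf.prob (H n) (B2 n)"
      by (intro measure_Un_le) auto
    also have "\<dots> \<le> real n powr (- (g / 2)) + (1 / 2) ^ n"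
      using prob_random_hypergraph_bad[OF c n] unfolding H_def B1_def B2_def g_def by (rule add_mono)
    finally have "1 - (real n powr (- (g / 2)) + (1 / 2) ^ n) \<le> 1 - measure_pmf.prob (H n) (B1 n \<union> B2 n)" by simp
    also have "\<dots> = measure_pmf.prob (H n) (- (B1 n \<union> B2 n))"
      by (simp add: measure_pmf.prob_compl[of "B1 n \<union> B2 n", simplified] Compl_eq_Diff_UNIV)
    also have "\<dots> = measure_pmf.expectation (H n) (indicator (- (B1 n \<union> B2 n)))" by simp
    also have "\<dots> \<le> measure_pmf.expectation (H n) ?f"
    proof (intro integral_mono_AE AE_pmfI)
      show "indicator (- (B1 n \<union> B2 n)) E \<le> ?f E" if "E \<in> set_pmf (H n)" for E
        using good[OF that _ _ n] by (auto simp: indicator_def)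
      show "integrable (measure_pmf (H n)) ?f"
        by (rule measure_pmf.integrable_const_bound[where B = 1]) (auto simp: pmf_le_1)
    qed (auto intro!: measure_pmf.integrable_const_bound[where B = 1])
    also have "\<dots> = measure_pmf.prob (bind_pmf (H n) (\<lambda>E. D (enc_hypergraph n (k n) E))) {Tip}"
      by (simp add: measure_pmf_single pmf_bind)
    finally show ?thesis .
  qed
  have "(\<lambda>n. measure_pmf.prob (bind_pmf (H n) (\<lambda>E. D (enc_hypergraph n (k n) E))) {Tip}) \<longlonglongrightarrow> 1"
  proof (rule tendsto_sandwich)
    show "\<forall>\<^sub>F n in sequentially. 1 - (real n powr (- (g / 2)) + (1 / 2) ^ n) \<le>
        measure_pmf.prob (bind_pmf (H n) (\<lambda>E. D (enc_hypergraph n (k n) E))) {Tip}"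
      using eventually_ge_at_top[of 16] by eventually_elim (rule lower)
    show "\<forall>\<^sub>F n in sequentially. measure_pmf.prob (bind_pmf (H n) (\<lambda>E. D (enc_hypergraph n (k n) E))) {Tip} \<le> 1"
      by simp
    show "(\<lambda>n. 1 - (real n powr (- (g / 2)) + (1 / 2) ^ n)) \<longlonglongrightarrow> 1"
      using g by real_asymp
  qed simp
  then show ?thesis by (simp add: H_def g_def)
qed

text \<open>The hypothesis on \<open>\<rho>\<close> speaks only about large m and k. Here both are
  large: the planted edges alone outnumber \<open>N0\<close>, and there are at least n
  labels.\<close>

lemma solves_dense:
  fixes e \<epsilon> :: real and c :: nat
  assumes c: "1 \<le> c" "1 / real c \<le> e" and e: "0 < e" "e \<le> 1 / 8" "e \<le> \<epsilon>"
    and \<beta>: "1 + 1 / real c / 4 \<le> \<beta>"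
    and A: "rb_approximates A \<rho>"
    and bound: "(\<lambda>(m, k). \<rho> m k) \<in> O[at_top \<times>\<^sub>F at_top](\<lambda>(m, k). rb_ratio \<epsilon> m k)"
    and D: "\<And>x. pmf (D x) Tip = pmf (trial c A x) Tip ^ size x"
    and "\<delta> > 0"
  shows "\<forall>\<^sub>F n in sequentially. \<forall>E \<in> dense_hypergraphs (3 * c) n (floor_sqrt_real n) \<beta>.
            measure_pmf.prob (D (enc_hypergraph n (floor_sqrt_real n) E)) (- {Tip}) \<ge> 1 - \<delta>"
proof -
  define g where "g = 1 / real c"
  have g: "0 < g" "g \<le> e" "g * real c = 1" "g \<le> 1" using c e by (auto simp: g_def)
  obtain C where C: "C > 0" "\<forall>\<^sub>F p in at_top \<times>\<^sub>F at_top. norm ((\<lambda>(m, k). \<rho> m k) p) \<le> C * norm ((\<lambda>(m, k). rb_ratio \<epsilon> m k) p)"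
    using bound by (auto elim!: landau_o.bigE)
  then obtain N0 where N0: "\<And>m k. N0 \<le> m \<Longrightarrow> N0 \<le> k \<Longrightarrow> \<bar>\<rho> m k\<bar> \<le> C * \<bar>rb_ratio \<epsilon> m k\<bar>"
    unfolding eventually_prod_sequentially by auto
  let ?\<kappa> = "\<lambda>n. real n powr (g / 8) / (16 * real (3 * c))"
  have "\<forall>\<^sub>F n in sequentially. 2 * real n * exp (- ?\<kappa> n) \<le> 1 / 4"
    using g(1) c(1) by real_asymp
  moreover have "\<forall>\<^sub>F n in sequentially. real N0 + 1 \<le> 2 * real n * ?\<kappa> n"
    using g(1) c(1) by real_asymp
  moreover have "\<forall>\<^sub>F n in sequentially. C * real n powr ((2 + g) * (1 / 4 - e)) * real n powr (1 / 2) \<le> real n powr (1 - g)"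
  proof -
    \<comment> \<open>The exponents of ratio and planted optimum, added up. The inequality amounts
      to \<open>5 / 4 * g < 2 * e + g * e\<close>, true by \<open>g \<le> e\<close>; being strict,
      it leaves room for the constant \<open>C\<close>.\<close>
    have "(2 + g) * (1 / 4 - e) + 1 / 2 < 1 - g"
    proof -
      have "(2 + g) * (1 / 4 - e) = 1 / 2 + g / 4 - 2 * e - g * e" by (simp add: algebra_simps)
      moreover have "0 \<le> g * e" using g e by simp
      ultimately show ?thesis using g(1,2) e(1) by linarith
    qed
    then have "\<forall>\<^sub>F n in sequentially. C * real n powr ((2 + g) * (1 / 4 - e) + 1 / 2) \<le> real n powr (1 - g)"
      using C(1) by real_asymp
    then show ?thesis by (simp add: powr_add mult.assoc)
  qed
  \<comment> \<open>The number of repetitions is the input size, hence at least n.\<close>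
  moreover have "\<forall>\<^sub>F n in sequentially. (7 / 12 :: real) ^ n \<le> \<delta>"
    using order_tendstoD(2)[OF LIMSEQ_realpow_zero[of "7 / 12 :: real"] \<open>\<delta> > 0\<close>] by (auto elim: eventually_mono)
  ultimately show ?thesis
    using eventually_ge_at_top[of "max 16 N0"]
  proof eventually_elim
    case (elim n)
    show ?case
    proof
      fix E assume "E \<in> dense_hypergraphs (3 * c) n (floor_sqrt_real n) \<beta>"
      then obtain V where E: "E \<subseteq> all_edges (3 * c) n" and V: "V \<subseteq> {..<n}" "card V = floor_sqrt_real n"
        "average_degree V (induced E V) \<ge> real (floor_sqrt_real n) powr \<beta>"
        unfolding dense_hypergraphs_def by blast
      let ?K = "card {e \<in> E. e \<subseteq> V}" and ?x = "enc_hypergraph n (floor_sqrt_real n) E"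
      have n: "16 \<le> n" "N0 \<le> n" using elim by auto
      have EP: "E \<subseteq> Pow {..<n}" using E all_edges_subset_Pow by blast
      have K: "2 * real n * ?\<kappa> n \<le> real ?K"
        using many_planted_edges[OF g(1,4) n(1) _ _ E V] \<beta> c by (simp add: g_def)
      have "?K \<le> card E" using E finite_all_edges by (intro card_mono) (auto intro: finite_subset)
      then have m: "N0 \<le> card E" "1 \<le> card E" using K elim by linarith+
      have L: "n \<le> 2 ^ lg n" by (rule le_two_power_lg)
      have "pmf (trial c A ?x) Tip \<le> 7 / 12"
      proof (rule pmf_trial_dense[OF A EP V(1)])
        show "2 ^ lg n * (1 - 1 / 2 ^ lg n) ^ ?K \<le> (1 / 4 :: real)"
          using hit_probability[OF _ K] n elim by simp
        assume small: "card E ^ c \<le> n ^ (2 * c + 1)"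
        have "(real n powr (2 + g)) ^ c = real n ^ (2 * c + 1)"
          using n by (intro powr_two_plus_power g) simp
        moreover have "real (card E) ^ c \<le> real n ^ (2 * c + 1)" using small by (metis of_nat_le_iff of_nat_power)
        ultimately have "real (card E) \<le> real n powr (2 + g)"
          using c power_mono_iff[of "real (card E)" "real n powr (2 + g)" c] by simp
        then have "rb_ratio \<epsilon> (card E) (2 ^ lg n) \<le> real n powr ((2 + g) * (1 / 4 - e))"
          using m L n by (intro rb_ratio_le e) auto
        moreover have "0 \<le> rb_ratio \<epsilon> (card E) (2 ^ lg n)" by (simp add: rb_ratio_def)
        moreover have "\<bar>\<rho> (card E) (2 ^ lg n)\<bar> \<le> C * \<bar>rb_ratio \<epsilon> (card E) (2 ^ lg n)\<bar>"
          using m L n by (intro N0) auto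
        ultimately have "\<bar>\<rho> (card E) (2 ^ lg n)\<bar> \<le> C * real n powr ((2 + g) * (1 / 4 - e))"
          using C(1) by (smt (verit) mult_left_mono)
        moreover have "real (card V) \<le> real n powr (1 / 2)"
          using floor_sqrt_real_bounds(1)[of n] V(2) by (simp add: powr_half_sqrt)
        ultimately have "\<bar>\<rho> (card E) (2 ^ lg n)\<bar> * real (card V) \<le>
            C * real n powr ((2 + g) * (1 / 4 - e)) * real n powr (1 / 2)"
          using C(1) by (intro mult_mono) auto
        also have "\<dots> \<le> real n powr (1 - g)" using elim by blast
        finally have "(\<bar>\<rho> (card E) (2 ^ lg n)\<bar> * real (card V)) ^ c \<le> (real n powr (1 - g)) ^ c"
          by (intro power_mono) auto
        also have "\<dots> = real n ^ (c - 1)"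
          using n by (intro powr_one_minus_power g c) simp
        finally show "(\<bar>\<rho> (card E) (2 ^ lg n)\<bar> * real (card V)) ^ c \<le> real n ^ (c - 1)" .
      qed
      then have "pmf (D ?x) Tip \<le> (7 / 12) ^ size ?x" unfolding D by (intro power_mono) auto
      also have "\<dots> \<le> (7 / 12) ^ n" using size_enc_hypergraph(1)[OF EP] by (intro power_decreasing) auto
      also have "\<dots> \<le> \<delta>" using elim by blast
      finally show "1 - \<delta> \<le> measure_pmf.prob (D ?x) (- {Tip})"
        by (simp add: measure_pmf.prob_compl[of "{Tip}", simplified] Compl_eq_Diff_UNIV measure_pmf_single)
    qed
  qed
qed

theorem theorem4:
  fixes \<epsilon> :: real
  assumes "hypergraph_dense_vs_random_conjecture" and "\<epsilon> > 0"
  shows "\<not> (\<exists>A \<rho>. rand_poly_time A \<and> rb_approximates A \<rho> \<and>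
           (\<lambda>(m, k). \<rho> m k) \<in> O[at_top \<times>\<^sub>F at_top](\<lambda>(m, k). rb_ratio \<epsilon> m k))"
proof
  assume "\<exists>A \<rho>. rand_poly_time A \<and> rb_approximates A \<rho> \<and>
           (\<lambda>(m, k). \<rho> m k) \<in> O[at_top \<times>\<^sub>F at_top](\<lambda>(m, k). rb_ratio \<epsilon> m k)"
  then obtain A \<rho> where A: "rand_poly_time A" "rb_approximates A \<rho>"
    "(\<lambda>(m, k). \<rho> m k) \<in> O[at_top \<times>\<^sub>F at_top](\<lambda>(m, k). rb_ratio \<epsilon> m k)" by blast
  \<comment> \<open>A loss above 1/8 is treated as 1/8, which keeps the exponent
    \<open>1 / 4 - e\<close> positive.\<close>
  define e where "e = min \<epsilon> (1 / 8)"
  have e: "0 < e" "e \<le> 1 / 8" "e \<le> \<epsilon>" using assms(2) by (auto simp: e_def)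
  obtain c where c: "c \<noteq> 0" "inverse (real c) < e" using real_arch_inverse[of e] e(1) by auto
  define g where "g = 1 / real c"
  have g: "0 < g" "g \<le> e" "g \<le> 1" and c1: "1 \<le> c" using c by (auto simp: g_def field_simps)
  let ?\<alpha> = "1 + g / 2" and ?r = "3 * c"
  have "2 \<le> ?r" "0 < ?\<alpha>" "?\<alpha> < real ?r - 1" using g c1 by auto
  then have "\<exists>\<epsilon>0 > 0. \<forall>\<epsilon>. 0 < \<epsilon> \<and> \<epsilon> < \<epsilon>0 \<longrightarrow> (\<forall>k :: nat \<Rightarrow> nat.
      (\<exists>c > 0. \<forall>\<^sub>F n in sequentially. real n powr c \<le> real (k n)) \<and>
      (\<forall>\<^sub>F n in sequentially. real (k n) powr (1 + (?\<alpha> - \<epsilon>)) \<le> real n powr ((1 + ?\<alpha>) / 2)) \<longrightarrow>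
      \<not> (\<exists>D. rand_poly_time D \<and> solves_dense_vs_random ?r ?\<alpha> (?\<alpha> - \<epsilon>) k D))"
    using assms(1)[unfolded hypergraph_dense_vs_random_conjecture_def, THEN spec[of _ ?r], THEN mp,
        THEN spec[of _ ?\<alpha>], THEN mp] by fast
  then obtain \<epsilon>0 where "\<epsilon>0 > 0" and \<epsilon>0: "\<And>\<epsilon> k. 0 < \<epsilon> \<Longrightarrow> \<epsilon> < \<epsilon>0 \<Longrightarrow>
      (\<exists>c > 0. \<forall>\<^sub>F n in sequentially. real n powr c \<le> real (k n)) \<Longrightarrow>
      (\<forall>\<^sub>F n in sequentially. real (k n) powr (1 + (?\<alpha> - \<epsilon>)) \<le> real n powr ((1 + ?\<alpha>) / 2)) \<Longrightarrow>
      \<not> (\<exists>D. rand_poly_time D \<and> solves_dense_vs_random ?r ?\<alpha> (?\<alpha> - \<epsilon>) k D)"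
    by blast
  \<comment> \<open>The conjecture dictates \<open>\<epsilon>0\<close>, which may be tiny. The
    second bound keeps the planted log-density at least \<open>1 + g / 4\<close>, so that the
    planted edges still outnumber the labels by a power of n.\<close>
  define \<eta> where "\<eta> = min (\<epsilon>0 / 2) (g / 4)"
  have \<eta>: "0 < \<eta>" "\<eta> < \<epsilon>0" "\<eta> \<le> g / 4" using \<open>\<epsilon>0 > 0\<close> g by (auto simp: \<eta>_def)
  obtain D where D: "rand_poly_time D" "\<And>x. pmf (D x) Tip = pmf (trial c A x) Tip ^ size x"
    using rand_poly_time_amplify[OF rand_poly_time_trial[OF A(1)]] by metis
  have "solves_dense_vs_random ?r ?\<alpha> (?\<alpha> - \<eta>) floor_sqrt_real D"
    unfolding solves_dense_vs_random_def
  proof (intro conjI allI impI)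
    show "(\<lambda>n. measure_pmf.prob (bind_pmf (random_hypergraph ?r n (real n powr (?\<alpha> - (real ?r - 1))))
        (\<lambda>E. D (enc_hypergraph n (floor_sqrt_real n) E))) {Tip}) \<longlonglongrightarrow> 1"
      using solves_random[OF c1 D(2)] by (simp add: g_def)
    fix \<delta> :: real assume "0 < \<delta>"
    show "\<forall>\<^sub>F n in sequentially. \<forall>E \<in> dense_hypergraphs ?r n (floor_sqrt_real n) (?\<alpha> - \<eta>).
            measure_pmf.prob (D (enc_hypergraph n (floor_sqrt_real n) E)) (- {Tip}) \<ge> 1 - \<delta>"
      using g \<eta> c1 e by (intro solves_dense[OF _ _ e _ A(2,3) D(2) \<open>0 < \<delta>\<close>]) (auto simp: g_def)
  qed
  moreover have "\<exists>c > 0. \<forall>\<^sub>F n in sequentially. real n powr c \<le> real (floor_sqrt_real n)"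
  proof (intro exI conjI)
    have "\<forall>\<^sub>F n in sequentially. real n powr (1 / 4) \<le> sqrt (real n) - 1" by real_asymp
    then show "\<forall>\<^sub>F n in sequentially. real n powr (1 / 4) \<le> real (floor_sqrt_real n)"
      by eventually_elim (use floor_sqrt_real_bounds(2) order_trans in blast)
  qed simp
  moreover have "\<forall>\<^sub>F n in sequentially. real (floor_sqrt_real n) powr (1 + (?\<alpha> - \<eta>)) \<le> real n powr ((1 + ?\<alpha>) / 2)"
    using eventually_ge_at_top[of 1]
  proof eventually_elim
    case (elim n)
    \<comment> \<open>As the planted part has at most sqrt n vertices, only the exponents
      \<open>1 + \<alpha> - \<eta>\<close> and \<open>1 + \<alpha>\<close> remain to be
      compared.\<close>
    have "real (floor_sqrt_real n) powr (1 + (?\<alpha> - \<eta>)) \<le> (real n powr (1 / 2)) powr (1 + (?\<alpha> - \<eta>))"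
      using floor_sqrt_real_bounds(1)[of n] g \<eta> by (intro powr_mono2) (auto simp: powr_half_sqrt)
    also have "\<dots> \<le> real n powr ((1 + ?\<alpha>) / 2)"
      unfolding powr_powr using elim \<eta> by (intro powr_mono) auto
    finally show ?case .
  qed
  ultimately show False using \<epsilon>0[OF \<eta>(1,2), of floor_sqrt_real] D(1) by blast
qed

end
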